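(* Let $s,L,Q>0$ and $\vartheta\in S_+^{d-1}$ be such that $\vartheta^\top X$ satisfies Assumption (D). Then $$\inf_{\tilde g}\ \sup_{f\in H^Q(s,L)} E^n\|\tilde g-g\|_{L^2(P_X)}^2\ \ge\ C'\,n^{-2s/(2s+1)},$$ where $g(\cdot)=f(\vartheta^\top\,\cdot)$, the infimum is taken among all estimators $\tilde g$ based on the sample $D_n$ of size $n$ from the single-index model, and $C'>0$ is a constant depending on $\sigma_1,s,L$ and $P_{\vartheta^\top X}$ only.
   Context: **Model.** $D_n=[(X_i,Y_i);1\le i\le n]$ is a sample of $n$ i.i.d. copies of $(X,Y)\in\mathbb R^d\times\mathbb R$ with $Y=g(X)+\sigma(X)\varepsilon$, where $\varepsilon\sim N(0,1)$ is independent of $X$ and $\sigma_0<\sigma(X)\le\sigma_1$ a.s. for some $\sigma_0>0$ and a known $\sigma_1>0$. $P_X$ is the law of $X$, $P_{\vartheta^\top X}$ the law of $\vartheta^\top X$, and $E^n$ is the expectation with respect to the joint law of $D_n$. The regression function has the form $g(x)=f(\vartheta^\top x)$, with link function $f:\mathbb R\to\mathbb R$ and index $\vartheta\in S_+^{d-1}:=\{v\in\mathbb R^d:\|v\|_2=1,\ v_d\ge0\}$. For identifiability the paper also assumes that $f$ is not constant over the support of $\vartheta^\top X$, that $X$ has at least one continuously distributed coordinate (w.r.t. Lebesgue measure), and that the support of $X$ is not contained in a linear subspace of $\mathbb R^d$. $\|g\|_{L^2(P_X)}^2:=\int g(x)^2P_X(dx)$. **Hölder classes.** $\lfloor s\rfloor$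 is the largest integer (strictly) smaller than $s$. $H(s,L)$ is the set of $f:\mathbb R\to\mathbb R$ such that $|f^{(\lfloor s\rfloor)}(z_1)-f^{(\lfloor s\rfloor)}(z_2)|\le L|z_1-z_2|^{s-\lfloor s\rfloor}$ for all $z_1,z_2\in\mathbb R$. $H^Q(s,L):=H(s,L)\cap\{f:\sup_x|f(x)|\le Q\}$. **Assumption (D)** for a real random variable $Z$ with law $P_Z$: $P_Z$ has a continuous density $\mu$ with respect to Lebesgue measure; moreover (i) $\mu$ is compactly supported; (ii) there is a finite number of $z$ in the support of $\mu$ with $\mu(z)=0$; (iii) for any such $z$ there is an interval $I_z=[z-a_z,z+b_z]$ ($a_z,b_z>0$) such that $\mu$ is decreasing (weakly) over $[z-a_z,z]$ and increasing (weakly) over $[z,z+b_z]$; (iv) there are $\beta\ge0$ and $\gamma>0$ such that $P_Z[I]\ge\gamma|I|^{\beta+1}$ for any interval $I$ contained in the support of $\mu$, where $|I|$ is the length of $I$.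
   Formalization: The constant may also depend on the lower noise bound σ_0; C' is independent of Q only for n ≥ N, where N may depend on Q, while for all n ≥ 1 the constant may depend on Q. As worded the claim fails when Q → 0 at n = 1, or when σ → 0. *)

theory Defs
  imports "HOL-Probability.Probability"
begin

text \<open>
  The dimension \<open>d\<close> has to be quantified after the constant of the lower bound, which must not
  depend on it. Hence \<open>\<real>\<^sup>d\<close> is not a type here: a vector is an extensional function on \<open>{..<d}\<close>,
  and laws on \<open>\<real>\<^sup>d\<close> are measures on the product Borel space below.
\<close>

abbreviation Rd :: "nat \<Rightarrow> (nat \<Rightarrow> real) measure" where
  "Rd d \<equiv> PiM {..<d} (\<lambda>_. borel)"

definition inner_d :: "nat \<Rightarrow> (nat \<Rightarrow> real) \<Rightarrow> (nat \<Rightarrow> real) \<Rightarrow> real" where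
  "inner_d d v x = (\<Sum>i<d. v i * x i)"

definition half_sphere :: "nat \<Rightarrow> (nat \<Rightarrow> real) set" where
  "half_sphere d = {v \<in> space (Rd d). L2_set v {..<d} = 1 \<and> 0 \<le> v (d - 1)}"

definition linear_subspace :: "nat \<Rightarrow> (nat \<Rightarrow> real) set \<Rightarrow> bool" where
  "linear_subspace d V \<longleftrightarrow> V \<subseteq> space (Rd d) \<and> (\<lambda>i\<in>{..<d}. 0) \<in> V
     \<and> (\<forall>u\<in>V. \<forall>v\<in>V. (\<lambda>i\<in>{..<d}. u i + v i) \<in> V)
     \<and> (\<forall>c. \<forall>v\<in>V. (\<lambda>i\<in>{..<d}. c * v i) \<in> V)"

definition law_support :: "nat \<Rightarrow> (nat \<Rightarrow> real) measure \<Rightarrow> (nat \<Rightarrow> real) set" where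
  "law_support d PX = {x \<in> space (Rd d). \<forall>r>0.
     0 < emeasure PX {y \<in> space (Rd d). L2_set (\<lambda>i. y i - x i) {..<d} < r}}"


subsection \<open>Hoelder classes\<close>

text \<open>Largest integer \<^emph>\<open>strictly\<close> smaller than \<open>s\<close>, for \<open>s > 0\<close>.\<close>

definition strict_floor :: "real \<Rightarrow> nat" where
  "strict_floor s = nat (\<lceil>s\<rceil> - 1)"

text \<open>\<open>deriv\<close> is total, so the existence of the iterated derivatives is required separately.\<close>

definition holder :: "real \<Rightarrow> real \<Rightarrow> (real \<Rightarrow> real) set" where
  "holder s L = {f. (\<forall>j<strict_floor s. \<forall>z. (deriv ^^ j) f differentiable (at z))
     \<and> (\<forall>z1 z2. \<bar>(deriv ^^ strict_floor s) f z1 - (deriv ^^ strict_floor s) f z2\<bar>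
              \<le> L * \<bar>z1 - z2\<bar> powr (s - real (strict_floor s)))}"

definition holder_bdd :: "real \<Rightarrow> real \<Rightarrow> real \<Rightarrow> (real \<Rightarrow> real) set" where
  "holder_bdd Q s L = holder s L \<inter> {f. \<forall>x. \<bar>f x\<bar> \<le> Q}"


subsection \<open>Assumption (D), for the law of a real random variable\<close>

definition density_support :: "(real \<Rightarrow> real) \<Rightarrow> real set" where
  "density_support \<mu> = closure {z. \<mu> z \<noteq> 0}"

definition assumption_D :: "real measure \<Rightarrow> bool" where
  "assumption_D P \<longleftrightarrow> prob_space P \<and> (\<exists>\<mu>.
     continuous_on UNIV \<mu> \<and> (\<forall>z. 0 \<le> \<mu> z) \<and> P = density lborel (\<lambda>z. ennreal (\<mu> z))
     \<and> compact (density_support \<mu>)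
     \<and> finite {z \<in> density_support \<mu>. \<mu> z = 0}
     \<and> (\<forall>z \<in> density_support \<mu>. \<mu> z = 0 \<longrightarrow>
          (\<exists>a>0. \<exists>b>0. antimono_on {z - a..z} \<mu> \<and> mono_on {z..z + b} \<mu>))
     \<and> (\<exists>\<beta>\<ge>0. \<exists>\<gamma>>0. \<forall>I. is_interval I \<and> I \<subseteq> density_support \<mu> \<longrightarrow>
          \<gamma> * measure lborel I powr (\<beta> + 1) \<le> measure P I))"


subsection \<open>The single-index model\<close>

text \<open>Conditions on the law \<open>PX\<close> of the design, the noise level \<open>\<sigma>\<close> and the index \<open>\<theta>\<close>.\<close>

definition single_index_design ::
  "nat \<Rightarrow> (nat \<Rightarrow> real) measure \<Rightarrow> ((nat \<Rightarrow> real) \<Rightarrow> real) \<Rightarrow> real \<Rightarrow> real \<Rightarrow> (nat \<Rightarrow> real) \<Rightarrow> bool"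
where
  "single_index_design d PX \<sigma> \<sigma>0 \<sigma>1 \<theta> \<longleftrightarrow>
     1 \<le> d \<and> prob_space PX \<and> sets PX = sets (Rd d)
     \<and> \<sigma> \<in> borel_measurable (Rd d) \<and> (AE x in PX. \<sigma>0 < \<sigma> x \<and> \<sigma> x \<le> \<sigma>1)
     \<and> \<theta> \<in> half_sphere d
     \<and> (\<exists>i<d. absolutely_continuous lborel (distr PX borel (\<lambda>x. x i)))
     \<and> (\<forall>V. linear_subspace d V \<and> V \<noteq> space (Rd d) \<longrightarrow> \<not> law_support d PX \<subseteq> V)"

definition index_law :: "nat \<Rightarrow> (nat \<Rightarrow> real) measure \<Rightarrow> (nat \<Rightarrow> real) \<Rightarrow> real measure" where
  "index_law d PX \<theta> = distr PX borel (inner_d d \<theta>)"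

text \<open>Law of \<open>(X, g X + \<sigma> X * \<epsilon>)\<close> with \<open>X\<close> of law \<open>PX\<close> and an independent standard normal \<open>\<epsilon>\<close>.\<close>

definition observation_law ::
  "nat \<Rightarrow> (nat \<Rightarrow> real) measure \<Rightarrow> ((nat \<Rightarrow> real) \<Rightarrow> real) \<Rightarrow> ((nat \<Rightarrow> real) \<Rightarrow> real)
     \<Rightarrow> ((nat \<Rightarrow> real) \<times> real) measure"
where
  "observation_law d PX \<sigma> g =
     distr (PX \<Otimes>\<^sub>M density lborel (\<lambda>e. ennreal (std_normal_density e))) (Rd d \<Otimes>\<^sub>M borel)
       (\<lambda>(x, e). (x, g x + \<sigma> x * e))"

definition sample_law ::
  "nat \<Rightarrow> nat \<Rightarrow> (nat \<Rightarrow> real) measure \<Rightarrow> ((nat \<Rightarrow> real) \<Rightarrow> real) \<Rightarrow> ((nat \<Rightarrow> real) \<Rightarrow> real)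
     \<Rightarrow> (nat \<Rightarrow> (nat \<Rightarrow> real) \<times> real) measure"
where
  "sample_law n d PX \<sigma> g = PiM {..<n} (\<lambda>_. observation_law d PX \<sigma> g)"

definition estimators ::
  "nat \<Rightarrow> nat \<Rightarrow> ((nat \<Rightarrow> (nat \<Rightarrow> real) \<times> real) \<Rightarrow> (nat \<Rightarrow> real) \<Rightarrow> real) set"
where
  "estimators n d = {ge. (\<lambda>(D, x). ge D x)
     \<in> borel_measurable (PiM {..<n} (\<lambda>_. Rd d \<Otimes>\<^sub>M borel) \<Otimes>\<^sub>M Rd d)}"

definition L2_loss ::
  "(nat \<Rightarrow> real) measure \<Rightarrow> ((nat \<Rightarrow> real) \<Rightarrow> real) \<Rightarrow> ((nat \<Rightarrow> real) \<Rightarrow> real) \<Rightarrow> ennreal"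
where
  "L2_loss PX g1 g2 = (\<integral>\<^sup>+ x. ennreal ((g1 x - g2 x)\<^sup>2) \<partial>PX)"

definition minimax_risk ::
  "nat \<Rightarrow> nat \<Rightarrow> (nat \<Rightarrow> real) measure \<Rightarrow> ((nat \<Rightarrow> real) \<Rightarrow> real) \<Rightarrow> (nat \<Rightarrow> real)
     \<Rightarrow> (real \<Rightarrow> real) set \<Rightarrow> ennreal"
where
  "minimax_risk n d PX \<sigma> \<theta> F =
     (INF ge \<in> estimators n d. SUP f \<in> F.
        let g = (\<lambda>x. f (inner_d d \<theta> x))
        in \<integral>\<^sup>+ D. L2_loss PX (ge D) g \<partial>sample_law n d PX \<sigma> g)"

end

theory Submission
  imports Defs
begin

text \<open>
  The regression functions depend on \<open>x\<close> through \<open>\<theta>\<^sup>T x\<close> only, so the squared distance of two of them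
  is the squared distance of their link functions in \<open>L\<^sup>2(P)\<close>. The classical hypercube argument
  (Assouad) for univariate regression can therefore be run on the link functions.

  Assumption (D) provides room for the hypercube: a continuous density is positive somewhere, hence
  on some interval \<open>[z0, z0 + r]\<close> the mass of every subinterval is comparable to its length, with
  constants \<open>c\<close> and \<open>4 c\<close> (\<open>assumption_D_interval\<close>). This interval is cut into \<open>m\<close> bins of width
  \<open>h = r / m\<close>, and a link function is attached to each \<open>w \<subseteq> {..<m}\<close>, namely the sum of the bumps of
  height of order \<open>A = a h\<^sup>s\<close> over the bins in \<open>w\<close>. The scaling \<open>h\<^sup>s\<close> is exactly what keeps the Hoelder
  constant bounded whatever \<open>h\<close> is (\<open>bump_sum_in_holder_bdd\<close>).

  Two sets that differ in one bin give laws of the sample that cannot be told apart: the second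
  moment of one likelihood ratio exceeds \<open>1\<close> by at most a multiple of \<open>A\<^sup>2 h / \<sigma>0\<^sup>2\<close>
  (\<open>chi_square_local_perturbation\<close>), so that over \<open>n\<close> observations it stays below \<open>2\<close> as soon as
  \<open>n h\<^bsup>2s+1\<^esup>\<close> is small. The two laws then share at least half of their mass (\<open>two_point_bound\<close>),
  and every estimator errs on that bin, under one law or the other, by a fixed fraction of the squared
  distance of the two link functions, which is of order \<open>A\<^sup>2 h\<close>. Averaging over all sets \<open>w\<close> adds up
  these errors over the \<open>m\<close> bins (\<open>assouad_averaging\<close>), so the risk is at least of order
  \<open>m A\<^sup>2 h = r A\<^sup>2\<close>. The choice \<open>m \<approx> n\<^bsup>1/(2s+1)\<^esup>\<close> gives \<open>A\<^sup>2\<close> the order \<open>n\<^bsup>-2s/(2s+1)\<^esup>\<close>.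

  The sup norm of the link functions is at most \<open>A\<close>, which tends to zero. The bound \<open>Q\<close> is thus
  respected for all large \<open>n\<close> with an amplitude \<open>a\<close> chosen before \<open>Q\<close>; for the statement about all
  \<open>n\<close> the amplitude is lowered once, depending on \<open>Q\<close>.
\<close>

section \<open>Polynomial bumps and their rescaled sums\<close>

definition zero_ext :: "real poly \<Rightarrow> real \<Rightarrow> real" where
  "zero_ext q x = (if 0 < x \<and> x < 1 then poly q x else 0)"

text \<open>
  The derivatives of a zero extension are controlled at the end points \<open>0\<close> and \<open>1\<close> only through the
  multiplicity of the roots of the polynomial there: a simple root gives continuity, and a double
  root, split as \<open>y - x\<close> times a polynomial with a root at \<open>x\<close>, gives differentiability by
  Caratheodory's characterisation.
\<close>

lemma isCont_zero_ext_root: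
  assumes "poly q x = 0" and "x = 0 \<or> x = 1"
  shows "isCont (zero_ext q) x"
proof -
  have "(\<lambda>y. poly q y) \<midarrow>x\<rightarrow> 0"
    using poly_isCont[where p=q and x=x] assms(1) by (simp add: isCont_def)
  then have "zero_ext q \<midarrow>x\<rightarrow> 0"
    by (rule Lim_null_comparison[rotated, OF tendsto_norm_zero]) (simp add: zero_ext_def)
  then show ?thesis
    using assms(2) by (auto simp: isCont_def zero_ext_def)
qed

lemma DERIV_zero_ext:
  assumes q: "[:0, 1, -1:]\<^sup>2 dvd q"
  shows "(zero_ext q has_real_derivative zero_ext (pderiv q) x) (at x)"
proof -
  consider "x = 0 \<or> x = 1" | "x < 0 \<or> 1 < x" | "0 < x" "x < 1" by linarith
  then show ?thesis
  proof cases
    case 1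
    have "[:-x, 1:] dvd [:0, 1, -1:]"
      using 1 by (intro iffD1[OF poly_eq_0_iff_dvd]) auto
    then have "[:-x, 1:]\<^sup>2 dvd q"
      using q by (meson dvd_power_same dvd_trans)
    then obtain r where "q = [:-x, 1:]\<^sup>2 * r"
      by (rule dvdE)
    then have r: "q = [:-x, 1:] * ([:-x, 1:] * r)"
      unfolding power2_eq_square mult.assoc .
    let ?q = "[:-x, 1:] * r"
    have "zero_ext q y - zero_ext q x = zero_ext ?q y * (y - x)" for y
      using 1 by (auto simp: zero_ext_def r algebra_simps)
    moreover have "isCont (zero_ext ?q) x"
      using 1 by (intro isCont_zero_ext_root) auto
    moreover have "zero_ext ?q x = zero_ext (pderiv q) x"
      using 1 by (auto simp: zero_ext_def)
    ultimately show ?thesis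
      unfolding CARAT_DERIV by blast
  next
    case 2
    have "((\<lambda>_. 0) has_real_derivative 0) (at x)" by simp
    moreover have "open ({..<0::real} \<union> {1<..})" by auto
    ultimately have "(zero_ext q has_real_derivative 0) (at x)"
      by (rule has_field_derivative_transform_within_open) (use 2 in \<open>auto simp: zero_ext_def\<close>)
    then show ?thesis using 2 by (auto simp: zero_ext_def)
  next
    case 3
    have "(zero_ext q has_real_derivative poly (pderiv q) x) (at x)"
      by (rule has_field_derivative_transform_within_open[OF poly_DERIV, of "{0<..<1}"])
        (use 3 in \<open>auto simp: zero_ext_def\<close>)
    then show ?thesis using 3 by (auto simp: zero_ext_def)
  qed
qed

lemma power_dvd_pderiv:
  fixes b q :: "real poly"
  assumes "b ^ Suc k dvd q"
  shows "b ^ k dvd pderiv q"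
proof -
  obtain r where r: "q = b ^ Suc k * r" using assms by (elim dvdE)
  show ?thesis
    unfolding r pderiv_mult pderiv_power_Suc
    by (intro dvd_add dvd_mult2 dvd_mult dvd_smult) (auto intro: le_imp_power_dvd simp del: power_Suc)
qed

text \<open>
  The \<open>j\<close>-th derivative of \<open>(x (1 - x))\<^bsup>N+2\<^esup>\<close>, extended by zero. Each differentiation costs one
  factor \<open>x (1 - x)\<close>, and differentiability of the extension needs two of them; the exponent \<open>N + 2\<close>
  thus leaves the \<open>N\<close>-th derivative differentiable with a bounded derivative, hence Lipschitz.
\<close>

definition bump :: "nat \<Rightarrow> nat \<Rightarrow> real \<Rightarrow> real" where
  "bump N j = zero_ext ((pderiv ^^ j) ([:0, 1, -1:] ^ (N + 2)))"

lemma DERIV_bump: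
  assumes "j \<le> N"
  shows "(bump N j has_real_derivative bump N (Suc j) x) (at x)"
proof -
  have "[:0, 1, -1:] ^ (N + 2 - j) dvd (pderiv ^^ j) ([:0, 1, -1:] ^ (N + 2) :: real poly)"
    using assms
  proof (induction j)
    case (Suc j)
    then have "[:0, 1, -1:] ^ Suc (N + 2 - Suc j) dvd (pderiv ^^ j) ([:0, 1, -1:] ^ (N + 2) :: real poly)"
      by (subst Suc_diff_Suc) (auto simp del: power_Suc)
    from power_dvd_pderiv[OF this] show ?case by simp
  qed simp
  moreover have "[:0, 1, -1:]\<^sup>2 dvd ([:0, 1, -1:] ^ (N + 2 - j) :: real poly)"
    using assms by (intro le_imp_power_dvd) simp
  ultimately show ?thesis
    unfolding bump_def funpow.simps comp_apply by (intro DERIV_zero_ext) (rule dvd_trans)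
qed

lemma bump_outside: "\<not> (0 < x \<and> x < 1) \<Longrightarrow> bump N j x = 0"
  by (auto simp: bump_def zero_ext_def)

lemma bump_bounded:
  obtains B where "0 < B" and "\<And>j x. j \<le> Suc N \<Longrightarrow> \<bar>bump N j x\<bar> \<le> B"
proof -
  have "\<exists>B. \<forall>x. \<bar>zero_ext q x\<bar> \<le> B" for q
  proof -
    have "compact (poly q ` {0..1})"
      by (intro compact_continuous_image continuous_intros) auto
    then obtain B where B: "\<forall>x\<in>{0..1}. \<bar>poly q x\<bar> \<le> B"
      by (auto dest!: compact_imp_bounded simp: bounded_iff)
    moreover from B have "\<bar>poly q 0\<bar> \<le> B" by simp
    then have "0 \<le> B" by linarith
    ultimately show ?thesis by (auto simp: zero_ext_def intro!: exI[of _ B])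
  qed
  then have "\<forall>j. \<exists>B. \<forall>x. \<bar>bump N j x\<bar> \<le> B"
    unfolding bump_def by blast
  then obtain b where b: "\<And>j x. \<bar>bump N j x\<bar> \<le> b j"
    unfolding choice_iff by blast
  then have "0 \<le> b j" for j by (meson abs_ge_zero order_trans)
  then have "\<bar>bump N j x\<bar> \<le> 1 + (\<Sum>i\<le>Suc N. b i)" "0 < 1 + (\<Sum>i\<le>Suc N. b i)" if "j \<le> Suc N" for j x
    using b[of j x] member_le_sum[of j "{..Suc N}" b] that sum_nonneg[of "{..Suc N}" b] by (auto simp del: sum.atMost_Suc)
  then show thesis by (intro that[of "1 + (\<Sum>i\<le>Suc N. b i)"]) auto
qed

lemma bump_0: "0 < x \<and> x < 1 \<Longrightarrow> bump N 0 x = (x * (1 - x)) ^ (N + 2)"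
  by (simp add: bump_def zero_ext_def poly_power algebra_simps del: power_Suc)

lemma bump_le_1: "\<bar>bump N 0 x\<bar> \<le> 1"
proof (cases "0 < x \<and> x < 1")
  case True
  then have "0 \<le> x * (1 - x)" "x * (1 - x) \<le> 1"
    by (auto intro: mult_le_one)
  then show ?thesis
    unfolding bump_0[OF True] by (subst abs_of_nonneg) (auto intro: power_le_one simp del: power_Suc)
qed (simp add: bump_outside)

lemma bump_middle:
  assumes "1/4 \<le> x" "x \<le> 3/4"
  shows "(3/16) ^ (N + 2) \<le> bump N 0 x"
proof -
  have "0 \<le> (x - 1/4) * (3/4 - x)" using assms by simp
  also have "\<dots> = x * (1 - x) - 3/16" by (simp add: field_simps)
  finally have "3/16 \<le> x * (1 - x)" by simp
  then show ?thesis
    using assms by (subst bump_0) (auto intro: power_mono simp del: power_Suc)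
qed

text \<open>
  The translates by natural numbers have disjoint supports: at any point at most one of them, the one
  named by the integer part, is nonzero.
\<close>

lemma bump_shift_nonzero: "bump N j (u - real k) \<noteq> 0 \<Longrightarrow> k = nat \<lfloor>u\<rfloor>"
proof -
  assume "bump N j (u - real k) \<noteq> 0"
  then have "0 < u - real k \<and> u - real k < 1" using bump_outside by blast
  then have "real k < u" "u < real k + 1" by auto
  then have "\<lfloor>u\<rfloor> = int k" by (intro floor_unique) auto
  then show ?thesis by simp
qed

text \<open>
  Bumps on the cells \<open>[c + k h, c + (k + 1) h]\<close> with \<open>k \<in> w\<close>; the parameter \<open>j\<close> gives the \<open>j\<close>-th
  derivative up to the factor \<open>h\<^bsup>-j\<^esup>\<close> of the rescaling.
\<close>

definition bump_sum :: "nat \<Rightarrow> nat \<Rightarrow> real \<Rightarrow> real \<Rightarrow> nat set \<Rightarrow> real \<Rightarrow> real" where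
  "bump_sum N j c h w z = (\<Sum>k\<in>w. bump N j ((z - c) / h - real k))"

lemma bump_sum_le_1:
  assumes "finite w"
  shows "\<bar>bump_sum N 0 c h w z\<bar> \<le> 1"
proof -
  let ?u = "(z - c) / h"
  have "bump_sum N 0 c h w z = (\<Sum>k\<in>w \<inter> {nat \<lfloor>?u\<rfloor>}. bump N 0 (?u - real k))"
    unfolding bump_sum_def using assms
    by (intro sum.mono_neutral_right) (auto dest: bump_shift_nonzero)
  also have "\<bar>\<dots>\<bar> \<le> 1"
    using bump_le_1 by (cases "nat \<lfloor>?u\<rfloor> \<in> w") auto
  finally show ?thesis .
qed

lemma DERIV_bump_sum:
  assumes "j \<le> N" "h \<noteq> 0"
  shows "(bump_sum N j c h w has_real_derivative bump_sum N (Suc j) c h w z / h) (at z)"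
proof -
  have "((\<lambda>z. bump N j ((z - c) / h - real k)) has_real_derivative
      bump N (Suc j) ((z - c) / h - real k) * (1 / h)) (at z)" for k
    by (rule DERIV_chain2[OF DERIV_bump[OF assms(1)]])
      (auto intro!: derivative_eq_intros simp: assms)
  then show ?thesis
    unfolding bump_sum_def[abs_def] sum_divide_distrib
    by (auto intro!: DERIV_sum)
qed

lemma iterated_deriv_bump_sum:
  assumes "j \<le> Suc N" "h \<noteq> 0"
  shows "(deriv ^^ j) (\<lambda>z. A * bump_sum N 0 c h w z) = (\<lambda>z. A / h ^ j * bump_sum N j c h w z)"
  using assms(1)
proof (induction j)
  case (Suc j)
  have "((\<lambda>z. A / h ^ j * bump_sum N j c h w z) has_real_derivative
      A / h ^ j * (bump_sum N (Suc j) c h w z / h)) (at z)" for z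
    using Suc assms by (intro DERIV_cmult DERIV_bump_sum) auto
  from DERIV_imp_deriv[OF this] show ?case
    using Suc by (simp add: mult.commute)
qed simp

text \<open>
  A bounded Lipschitz function is Hoelder of every exponent \<open>\<alpha> \<le> 1\<close>: at distances up to \<open>1\<close> the
  Lipschitz bound is the stronger one, and beyond that boundedness suffices.
\<close>

lemma bump_holder:
  assumes B: "\<And>j x. j \<le> Suc N \<Longrightarrow> \<bar>bump N j x\<bar> \<le> B" and \<alpha>: "0 < \<alpha>" "\<alpha> \<le> 1"
  shows "\<bar>bump N N x - bump N N y\<bar> \<le> 2 * B * \<bar>x - y\<bar> powr \<alpha>"
proof -
  have B0: "0 \<le> B" using B[of 0 0] by auto
  show ?thesis
  proof (cases "\<bar>x - y\<bar> \<le> 1")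
    case True
    have lip: "\<bar>bump N N x - bump N N y\<bar> \<le> B * \<bar>x - y\<bar>"
      using field_differentiable_bound[of UNIV "bump N N" "bump N (Suc N)" B x y] B[of "Suc N"] DERIV_bump[of N N]
      by (auto intro: has_field_derivative_at_within)
    have "\<bar>x - y\<bar> \<le> \<bar>x - y\<bar> powr \<alpha>"
    proof (cases "x = y")
      case False
      then have "\<bar>x - y\<bar> powr 1 \<le> \<bar>x - y\<bar> powr \<alpha>"
        using True \<alpha> by (intro powr_mono') auto
      then show ?thesis using False by simp
    qed auto
    then have "B * \<bar>x - y\<bar> \<le> 2 * B * \<bar>x - y\<bar> powr \<alpha>"
      using B0 by (intro mult_mono) auto
    with lip show ?thesis by linarith
  next
    case False
    then have "2 * B * 1 \<le> 2 * B * \<bar>x - y\<bar> powr \<alpha>"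
      using B0 \<alpha> by (intro mult_left_mono ge_one_powr_ge_zero) auto
    moreover have "\<bar>bump N N x - bump N N y\<bar> \<le> \<bar>bump N N x\<bar> + \<bar>bump N N y\<bar>" by linarith
    ultimately show ?thesis using B[of N x] B[of N y] by simp
  qed
qed

text \<open>
  Although the sum has arbitrarily many terms, at most two of them, the cells of \<open>x\<close> and of \<open>y\<close>,
  contribute to the difference. The Hoelder constant is therefore twice that of a single bump and does
  not grow with \<open>w\<close>.
\<close>

lemma bump_sum_holder:
  assumes "finite w"
    and B: "\<And>j x. j \<le> Suc N \<Longrightarrow> \<bar>bump N j x\<bar> \<le> B" and \<alpha>: "0 < \<alpha>" "\<alpha> \<le> 1"
  shows "\<bar>bump_sum N N c h w x - bump_sum N N c h w y\<bar> \<le> 4 * B * \<bar>(x - y) / h\<bar> powr \<alpha>"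
proof -
  let ?u = "(x - c) / h" and ?v = "(y - c) / h"
  let ?S = "w \<inter> {nat \<lfloor>?u\<rfloor>, nat \<lfloor>?v\<rfloor>}"
  let ?T = "2 * B * \<bar>(x - y) / h\<bar> powr \<alpha>"
  have uv: "?u - ?v = (x - y) / h" by (simp add: diff_divide_distrib[symmetric])
  have "bump_sum N N c h w x - bump_sum N N c h w y
      = (\<Sum>k\<in>w. bump N N (?u - real k) - bump N N (?v - real k))"
    by (simp add: bump_sum_def sum_subtractf)
  also have "\<dots> = (\<Sum>k\<in>?S. bump N N (?u - real k) - bump N N (?v - real k))"
    using assms(1) by (intro sum.mono_neutral_right) (auto, metis bump_shift_nonzero)
  also have "\<bar>\<dots>\<bar> \<le> (\<Sum>k\<in>?S. ?T)"
  proof (rule order_trans[OF sum_abs sum_mono])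
    fix k
    show "\<bar>bump N N (?u - real k) - bump N N (?v - real k)\<bar> \<le> ?T"
      using bump_holder[OF B \<alpha>, of "?u - real k" "?v - real k"] uv by simp
  qed
  also have "\<dots> = card ?S * ?T" by simp
  also have "\<dots> \<le> 2 * ?T"
  proof (intro mult_right_mono)
    have "card ?S \<le> card {nat \<lfloor>?u\<rfloor>, nat \<lfloor>?v\<rfloor>}" by (intro card_mono) auto
    also have "\<dots> \<le> 2" by (simp add: card_insert_if)
    finally show "real (card ?S) \<le> 2" by simp
    show "0 \<le> ?T" using B[of 0 0] by auto
  qed
  finally show ?thesis by simp
qed

lemma measurable_bump_sum[measurable]: "bump_sum N 0 c h w \<in> borel_measurable borel"
proof (cases "h = 0")
  case False
  then show ?thesis
    by (intro borel_measurable_continuous_onI continuous_at_imp_continuous_on ballI)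
      (metis DERIV_bump_sum DERIV_isCont le0)
qed (simp add: bump_sum_def[abs_def])

lemma bump_sum_insert:
  "finite w \<Longrightarrow> k \<notin> w \<Longrightarrow>
    bump_sum N j c h (insert k w) z = bump N j ((z - c) / h - real k) + bump_sum N j c h w z"
  by (simp add: bump_sum_def)

text \<open>
  Taking \<open>N = strict_floor s\<close> derivatives costs \<open>h\<^bsup>-N\<^esup>\<close> and the rescaled argument costs \<open>h\<^bsup>-(s-N)\<^esup>\<close>; the
  height \<open>h\<^sup>s\<close> compensates both exactly.
\<close>

lemma bump_sum_in_holder_bdd:
  fixes s a h Q L B c :: real
  defines "N \<equiv> strict_floor s"
  assumes s: "0 < s" and h: "0 < h" and a: "0 \<le> a" and w: "finite w"
    and B: "\<And>j x. j \<le> Suc N \<Longrightarrow> \<bar>bump N j x\<bar> \<le> B"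
    and L: "4 * a * B \<le> L" and Q: "a * h powr s \<le> Q"
  shows "(\<lambda>z. a * h powr s * bump_sum N 0 c h w z) \<in> holder_bdd Q s L"
proof -
  let ?A = "a * h powr s" and ?\<alpha> = "s - real N"
  let ?f = "\<lambda>z. ?A * bump_sum N 0 c h w z"
  have \<alpha>: "0 < ?\<alpha>" "?\<alpha> \<le> 1"
    unfolding N_def strict_floor_def using s by (auto simp: of_nat_nat) linarith+
  have diff: "(deriv ^^ j) ?f differentiable (at z)" if "j < N" for j z
  proof -
    have "((\<lambda>z. ?A / h ^ j * bump_sum N j c h w z) has_real_derivative
        ?A / h ^ j * (bump_sum N (Suc j) c h w z / h)) (at z)"
      using that h by (intro DERIV_cmult DERIV_bump_sum) auto
    then show ?thesis
      using that h by (subst iterated_deriv_bump_sum) (auto simp: real_differentiable_def)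
  qed
  have hold: "\<bar>(deriv ^^ N) ?f x - (deriv ^^ N) ?f y\<bar> \<le> L * \<bar>x - y\<bar> powr ?\<alpha>" for x y
  proof -
    have "\<bar>(deriv ^^ N) ?f x - (deriv ^^ N) ?f y\<bar>
        = ?A / h ^ N * \<bar>bump_sum N N c h w x - bump_sum N N c h w y\<bar>"
      using h a by (subst (1 2) iterated_deriv_bump_sum)
        (auto simp: abs_mult right_diff_distrib[symmetric] simp flip: times_divide_eq_left)
    also have "\<dots> \<le> ?A / h ^ N * (4 * B * \<bar>(x - y) / h\<bar> powr ?\<alpha>)"
      using h a by (intro mult_left_mono bump_sum_holder w B \<alpha>) auto
    also have "\<dots> = 4 * a * B * \<bar>x - y\<bar> powr ?\<alpha>"
    proof -
      have "h powr s = h ^ N * h powr ?\<alpha>"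
        using h by (simp add: powr_diff powr_realpow)
      then show ?thesis
        using h by (simp add: abs_divide powr_divide)
    qed
    also have "\<dots> \<le> L * \<bar>x - y\<bar> powr ?\<alpha>"
      using L by (intro mult_right_mono) auto
    finally show ?thesis .
  qed
  have "\<bar>?f x\<bar> \<le> Q" for x
  proof -
    have "\<bar>?f x\<bar> \<le> ?A * 1"
      unfolding abs_mult using a bump_sum_le_1[OF w, of N c h x] by (intro mult_mono) auto
    then show ?thesis using Q by simp
  qed
  then show ?thesis
    using diff hold by (auto simp: holder_bdd_def holder_def N_def)
qed

section \<open>Distinguishing two product measures\<close>

lemma PiM_density:
  fixes l :: "'a \<Rightarrow> ennreal"
  assumes fin: "finite I" and l[measurable]: "l \<in> borel_measurable M"
    and M: "prob_space M" and M1: "prob_space (density M l)"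
  shows "PiM I (\<lambda>_. density M l) = density (PiM I (\<lambda>_. M)) (\<lambda>D. \<Prod>i\<in>I. l (D i))"
proof -
  interpret M: prob_space M by fact
  interpret M1: prob_space "density M l" by fact
  interpret P: product_sigma_finite "\<lambda>_. M" by standard
  interpret P1: product_sigma_finite "\<lambda>_. density M l" by standard
  have "density (PiM I (\<lambda>_. M)) (\<lambda>D. \<Prod>i\<in>I. l (D i)) = PiM I (\<lambda>_. density M l)"
  proof (rule P1.PiM_eqI[OF fin])
    show "sets (density (PiM I (\<lambda>_. M)) (\<lambda>D. \<Prod>i\<in>I. l (D i))) = sets (PiM I (\<lambda>_. density M l))"
      by (simp cong: sets_PiM_cong)
  next
    fix A assume "\<And>i. i \<in> I \<Longrightarrow> A i \<in> sets (density M l)"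
    then have A[measurable]: "i \<in> I \<Longrightarrow> A i \<in> sets M" for i by simp
    have box: "PiE I A \<in> sets (PiM I (\<lambda>_. M))"
      using fin A by (intro sets_PiM_I_finite) auto
    have "emeasure (density (PiM I (\<lambda>_. M)) (\<lambda>D. \<Prod>i\<in>I. l (D i))) (PiE I A)
        = (\<integral>\<^sup>+D. (\<Prod>i\<in>I. l (D i)) * indicator (PiE I A) D \<partial>PiM I (\<lambda>_. M))"
      using box by (simp add: emeasure_density)
    also have "\<dots> = (\<integral>\<^sup>+D. (\<Prod>i\<in>I. l (D i) * indicator (A i) (D i)) \<partial>PiM I (\<lambda>_. M))"
    proof (intro nn_integral_cong)
      fix D assume "D \<in> space (PiM I (\<lambda>_. M))"
      then have "D \<in> extensional I" by (auto simp: space_PiM PiE_def)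
      then have "indicator (PiE I A) D = (\<Prod>i\<in>I. indicator (A i) (D i) :: ennreal)"
        using fin by (auto simp: indicator_def PiE_def Pi_def)
      then show "(\<Prod>i\<in>I. l (D i)) * indicator (PiE I A) D = (\<Prod>i\<in>I. l (D i) * indicator (A i) (D i))"
        by (simp add: prod.distrib)
    qed
    also have "\<dots> = (\<Prod>i\<in>I. \<integral>\<^sup>+y. l y * indicator (A i) y \<partial>M)"
      by (rule P.product_nn_integral_prod[OF fin, where f = "\<lambda>i y. l y * indicator (A i) y"]) measurable
    also have "\<dots> = (\<Prod>i\<in>I. emeasure (density M l) (A i))"
      by (intro prod.cong) (auto simp: emeasure_density)
    finally show "emeasure (density (PiM I (\<lambda>_. M)) (\<lambda>D. \<Prod>i\<in>I. l (D i))) (PiE I A)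
        = (\<Prod>i\<in>I. emeasure (density M l) (A i))" .
  qed
  then show ?thesis ..
qed

text \<open>
  For \<open>x > 1\<close> this is \<open>(1 - x / 2)\<^sup>2 \<ge> 0\<close>. It bounds the overlap \<open>min 1 x\<close> of two measures with density
  ratio \<open>x\<close> from below by the first two moments of \<open>x\<close>.
\<close>

lemma le_min_one_plus_square:
  fixes x :: ennreal
  shows "x \<le> min 1 x + ennreal (1 / 4) * x\<^sup>2"
proof (cases x)
  case (real r)
  have "r \<le> min 1 r + (1 / 4) * r\<^sup>2"
    using real sum_squares_ge_zero[of "1 - r / 2" 0]
    by (cases "r \<le> 1") (auto simp: min_def power2_eq_square algebra_simps)
  then have "ennreal r \<le> ennreal (min 1 r) + ennreal (1 / 4) * ennreal (r\<^sup>2)"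
    using real by (simp add: ennreal_mult[symmetric] ennreal_plus[symmetric] del: ennreal_plus)
  then show ?thesis
    using real by (simp add: ennreal_power min_def ennreal_le_1 del: ennreal_1)
      (auto simp: ennreal_1[symmetric] simp del: ennreal_1)
next
  case top
  then show ?thesis by (simp add: power2_eq_square ennreal_mult_top)
qed

text \<open>
  Le Cam's two-point argument. Restricting both integrals to the common part of the two measures,
  which has density \<open>min 1 R\<close> with respect to the first, leaves the integral of \<open>u + v \<ge> t\<close> over the
  common part. The total mass of that part is at least \<open>E R - E R\<^sup>2 / 4\<close>, where \<open>E R = 1\<close>; the second
  moment \<open>E R\<^sup>2\<close> of a product density is the \<open>n\<close>-th power of that of one factor.
\<close>

lemma two_point_bound:
  fixes l :: "'a \<Rightarrow> ennreal"
  assumes l[measurable]: "l \<in> borel_measurable M"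
    and M: "prob_space M" and M1: "prob_space (density M l)"
    and chi2: "(\<integral>\<^sup>+y. (l y)\<^sup>2 \<partial>M) ^ n \<le> 2"
    and u[measurable]: "u \<in> borel_measurable (PiM {..<n} (\<lambda>_. M))"
    and v[measurable]: "v \<in> borel_measurable (PiM {..<n} (\<lambda>_. M))"
    and uv: "\<And>D. D \<in> space (PiM {..<n} (\<lambda>_. M)) \<Longrightarrow> t \<le> u D + v D"
  shows "t / 2 \<le> (\<integral>\<^sup>+D. u D \<partial>PiM {..<n} (\<lambda>_. M)) + (\<integral>\<^sup>+D. v D \<partial>PiM {..<n} (\<lambda>_. density M l))"
proof -
  interpret M: prob_space M by fact
  interpret M1: prob_space "density M l" by fact
  interpret P: product_sigma_finite "\<lambda>_. M" by standard
  interpret P1: product_prob_space "\<lambda>_. density M l" "{..<n}" by standard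
  define R where "R = (\<lambda>D. \<Prod>i<n. l (D i))"
  let ?P = "PiM {..<n} (\<lambda>_. M)"
  have R[measurable]: "R \<in> borel_measurable ?P"
    unfolding R_def by measurable
  have dens: "PiM {..<n} (\<lambda>_. density M l) = density ?P R"
    unfolding R_def by (rule PiM_density) (use l M M1 in auto)
  have R1: "(\<integral>\<^sup>+D. R D \<partial>?P) = 1"
    using P1.P.emeasure_space_1 R by (simp add: dens emeasure_density cong: nn_integral_cong)
  have "(\<integral>\<^sup>+D. (R D)\<^sup>2 \<partial>?P) = (\<integral>\<^sup>+D. (\<Prod>i<n. (l (D i))\<^sup>2) \<partial>?P)"
    by (simp add: R_def prod_power_distrib)
  also have "\<dots> = (\<integral>\<^sup>+y. (l y)\<^sup>2 \<partial>M) ^ n"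
    by (subst P.product_nn_integral_prod[where f = "\<lambda>_ y. (l y)\<^sup>2"]) auto
  finally have R2: "(\<integral>\<^sup>+D. (R D)\<^sup>2 \<partial>?P) \<le> 2"
    using chi2 by simp
  have "1 \<le> (\<integral>\<^sup>+D. min 1 (R D) + ennreal (1 / 4) * (R D)\<^sup>2 \<partial>?P)"
    using nn_integral_mono[of ?P R "\<lambda>D. min 1 (R D) + ennreal (1 / 4) * (R D)\<^sup>2"]
    by (simp add: le_min_one_plus_square R1)
  also have "\<dots> = (\<integral>\<^sup>+D. min 1 (R D) \<partial>?P) + ennreal (1 / 4) * (\<integral>\<^sup>+D. (R D)\<^sup>2 \<partial>?P)"
    by (simp add: nn_integral_add nn_integral_cmult)
  also have "\<dots> \<le> (\<integral>\<^sup>+D. min 1 (R D) \<partial>?P) + ennreal (1 / 4) * 2"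
    using R2 by (intro add_mono mult_left_mono) auto
  also have "ennreal (1 / 4) * 2 = ennreal (1/2)"
    using ennreal_mult[of "1/4" 2] by simp
  finally have "1 \<le> (\<integral>\<^sup>+D. min 1 (R D) \<partial>?P) + ennreal (1/2)" .
  then have "1 \<le> ennreal (1/2) + (\<integral>\<^sup>+D. min 1 (R D) \<partial>?P)"
    by (rule order_trans) (rule eq_refl[OF add.commute])
  moreover have "ennreal (1/2) + ennreal (1/2) = 1"
    using ennreal_plus[of "1/2" "1/2"] by (simp only: field_sum_of_halves) simp
  ultimately have "ennreal (1/2) + ennreal (1/2) \<le> ennreal (1/2) + (\<integral>\<^sup>+D. min 1 (R D) \<partial>?P)"
    by (blast intro: ord_eq_le_trans)
  then have aff: "ennreal (1/2) \<le> (\<integral>\<^sup>+D. min 1 (R D) \<partial>?P)"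
    unfolding ennreal_add_left_cancel_le by simp
  have "ennreal (1/2) = inverse 2"
    using inverse_ennreal[of 2] by (simp add: inverse_eq_divide)
  then have "t / 2 = t * ennreal (1/2)"
    by (simp only: divide_ennreal_def)
  also have "\<dots> \<le> t * (\<integral>\<^sup>+D. min 1 (R D) \<partial>?P)"
    by (intro mult_left_mono aff) auto
  also have "\<dots> = (\<integral>\<^sup>+D. t * min 1 (R D) \<partial>?P)"
    by (simp add: nn_integral_cmult)
  also have "\<dots> \<le> (\<integral>\<^sup>+D. u D + R D * v D \<partial>?P)"
  proof (intro nn_integral_mono)
    fix D assume D: "D \<in> space ?P"
    have "t * min 1 (R D) \<le> (u D + v D) * min 1 (R D)"
      by (intro mult_right_mono uv D) auto
    also have "\<dots> = u D * min 1 (R D) + v D * min 1 (R D)"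
      by (simp add: distrib_right)
    also have "\<dots> \<le> u D * 1 + v D * R D"
      by (intro add_mono mult_left_mono) auto
    finally show "t * min 1 (R D) \<le> u D + R D * v D"
      by (simp add: mult.commute)
  qed
  also have "\<dots> = (\<integral>\<^sup>+D. u D \<partial>?P) + (\<integral>\<^sup>+D. v D \<partial>PiM {..<n} (\<lambda>_. density M l))"
    by (simp add: dens nn_integral_add nn_integral_density)
  finally show ?thesis .
qed

section \<open>The likelihood ratio of two regression functions\<close>

definition std_normal :: "real measure" where
  "std_normal = density lborel (\<lambda>e. ennreal (std_normal_density e))"

lemma prob_space_std_normal: "prob_space std_normal"
  unfolding std_normal_def by (rule prob_space_normal_density) simp

lemma sets_std_normal[measurable_cong]: "sets std_normal = sets borel"
  by (simp add: std_normal_def)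

lemma std_normal_density_shift:
  "std_normal_density (e - t) = std_normal_density e * exp (e * t - t\<^sup>2 / 2)"
  by (simp add: std_normal_density_def mult_exp_exp power2_eq_square field_simps)

text \<open>
  The Cameron-Martin formula on the real line.
\<close>

lemma nn_integral_std_normal_shift:
  assumes [measurable]: "f \<in> borel_measurable borel"
  shows "(\<integral>\<^sup>+e. f (e + t) \<partial>std_normal) = (\<integral>\<^sup>+e. ennreal (exp (e * t - t\<^sup>2 / 2)) * f e \<partial>std_normal)"
proof -
  have "(\<integral>\<^sup>+e. f (e + t) \<partial>std_normal) = (\<integral>\<^sup>+e. ennreal (std_normal_density e) * f (e + t) \<partial>lborel)"
    unfolding std_normal_def by (simp add: nn_integral_density)
  also have "\<dots> = (\<integral>\<^sup>+e. ennreal (std_normal_density (e - t)) * f e \<partial>lborel)"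
    using nn_integral_real_affine[of "\<lambda>e. ennreal (std_normal_density (e - t)) * f e" 1 t]
    by (simp add: add.commute)
  also have "\<dots> = (\<integral>\<^sup>+e. ennreal (exp (e * t - t\<^sup>2 / 2)) * f e \<partial>std_normal)"
    unfolding std_normal_def
    by (simp add: nn_integral_density std_normal_density_shift ennreal_mult mult.assoc)
  finally show ?thesis .
qed

lemma nn_integral_std_normal_exp:
  "(\<integral>\<^sup>+e. ennreal (exp (e * t - t\<^sup>2 / 2)) \<partial>std_normal) = 1"
  using nn_integral_std_normal_shift[of "\<lambda>_. 1" t] prob_space.emeasure_space_1[OF prob_space_std_normal]
  by simp

lemma nn_integral_observation_law:
  assumes PX: "prob_space PX" "sets PX = sets (Rd d)"
    and [measurable]: "\<sigma> \<in> borel_measurable (Rd d)" "g \<in> borel_measurable (Rd d)"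
    and [measurable]: "u \<in> borel_measurable (Rd d \<Otimes>\<^sub>M borel)"
  shows "(\<integral>\<^sup>+z. u z \<partial>observation_law d PX \<sigma> g) = (\<integral>\<^sup>+x. \<integral>\<^sup>+e. u (x, g x + \<sigma> x * e) \<partial>std_normal \<partial>PX)"
proof -
  interpret N: prob_space std_normal by (rule prob_space_std_normal)
  note [measurable_cong] = PX(2)
  show ?thesis
    unfolding observation_law_def std_normal_def[symmetric]
    by (subst nn_integral_distr) (auto simp: N.nn_integral_fst[symmetric])
qed

lemma prob_space_observation_law:
  assumes PX: "prob_space PX" "sets PX = sets (Rd d)"
    and [measurable]: "\<sigma> \<in> borel_measurable (Rd d)" "g \<in> borel_measurable (Rd d)"
  shows "prob_space (observation_law d PX \<sigma> g)"
proof -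
  interpret N: prob_space std_normal by (rule prob_space_std_normal)
  interpret PX: prob_space PX by (rule PX)
  interpret pair_prob_space PX std_normal ..
  note [measurable_cong] = PX(2)
  show ?thesis
    unfolding observation_law_def std_normal_def[symmetric]
    by (rule P.prob_space_distr) measurable
qed

lemma sets_observation_law[measurable_cong]:
  "sets (observation_law d PX \<sigma> g) = sets (Rd d \<Otimes>\<^sub>M borel)"
  by (simp add: observation_law_def)

text \<open>
  With \<open>e\<close> the standardised residual under \<open>g0\<close> and \<open>t\<close> the standardised difference of the two means,
  this is the Cameron-Martin density, i.e. the quotient of the normal densities with means \<open>g1 x\<close> and
  \<open>g0 x\<close> and standard deviation \<open>\<sigma> x\<close>.
\<close>

definition likelihood_ratio ::
  "('a \<Rightarrow> real) \<Rightarrow> ('a \<Rightarrow> real) \<Rightarrow> ('a \<Rightarrow> real) \<Rightarrow> 'a \<times> real \<Rightarrow> ennreal"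
where
  "likelihood_ratio \<sigma> g0 g1 = (\<lambda>(x, y). let t = (g1 x - g0 x) / \<sigma> x; e = (y - g0 x) / \<sigma> x in
      ennreal (exp (e * t - t\<^sup>2 / 2)))"

lemma measurable_likelihood_ratio[measurable]:
  assumes [measurable]: "\<sigma> \<in> borel_measurable M" "g0 \<in> borel_measurable M" "g1 \<in> borel_measurable M"
  shows "likelihood_ratio \<sigma> g0 g1 \<in> borel_measurable (M \<Otimes>\<^sub>M borel)"
  unfolding likelihood_ratio_def Let_def by measurable

text \<open>
  Given \<open>x\<close>, passing from \<open>g0\<close> to \<open>g1\<close> shifts the noise by \<open>t = (g1 x - g0 x) / \<sigma> x\<close>, so the
  Cameron-Martin formula applies fibrewise.
\<close>

lemma observation_law_density:
  assumes PX: "prob_space PX" "sets PX = sets (Rd d)"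
    and [measurable]: "\<sigma> \<in> borel_measurable (Rd d)" "g0 \<in> borel_measurable (Rd d)" "g1 \<in> borel_measurable (Rd d)"
    and pos: "AE x in PX. 0 < \<sigma> x"
  shows "observation_law d PX \<sigma> g1 = density (observation_law d PX \<sigma> g0) (likelihood_ratio \<sigma> g0 g1)"
    (is "_ = density ?M0 ?l")
proof (rule measure_eqI)
  fix A assume "A \<in> sets (observation_law d PX \<sigma> g1)"
  then have A[measurable]: "A \<in> sets (Rd d \<Otimes>\<^sub>M borel)" by (simp add: observation_law_def)
  note [measurable_cong] = PX(2)
  have "emeasure (observation_law d PX \<sigma> g1) A = (\<integral>\<^sup>+z. indicator A z \<partial>observation_law d PX \<sigma> g1)"
    by (simp add: sets_observation_law)
  also have "\<dots> = (\<integral>\<^sup>+x. \<integral>\<^sup>+e. indicator A (x, g1 x + \<sigma> x * e) \<partial>std_normal \<partial>PX)"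
    by (rule nn_integral_observation_law[OF PX]) measurable
  also have "\<dots> = (\<integral>\<^sup>+x. \<integral>\<^sup>+e. ?l (x, g0 x + \<sigma> x * e) * indicator A (x, g0 x + \<sigma> x * e) \<partial>std_normal \<partial>PX)"
    using pos AE_space[of PX]
  proof (intro nn_integral_cong_AE, eventually_elim)
    case (elim x)
    have x[measurable]: "x \<in> space (Rd d)" using elim sets_eq_imp_space_eq[OF PX(2)] by simp
    let ?t = "(g1 x - g0 x) / \<sigma> x"
    have [measurable]: "(\<lambda>e. indicator A (x, g0 x + \<sigma> x * e) :: ennreal) \<in> borel_measurable borel"
      by measurable
    have "(\<integral>\<^sup>+e. indicator A (x, g1 x + \<sigma> x * e) \<partial>std_normal)
        = (\<integral>\<^sup>+e. indicator A (x, g0 x + \<sigma> x * (e + ?t)) \<partial>std_normal)"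
    proof -
      have "g1 x + \<sigma> x * e = g0 x + \<sigma> x * (e + ?t)" for e
        using elim by (simp add: field_simps)
      then show ?thesis by simp
    qed
    also have "\<dots> = (\<integral>\<^sup>+e. ennreal (exp (e * ?t - ?t\<^sup>2 / 2)) * indicator A (x, g0 x + \<sigma> x * e) \<partial>std_normal)"
      by (rule nn_integral_std_normal_shift) measurable
    also have "\<dots> = (\<integral>\<^sup>+e. ?l (x, g0 x + \<sigma> x * e) * indicator A (x, g0 x + \<sigma> x * e) \<partial>std_normal)"
      using elim by (simp add: likelihood_ratio_def Let_def)
    finally show ?case .
  qed
  also have "\<dots> = (\<integral>\<^sup>+z. ?l z * indicator A z \<partial>?M0)"
    by (rule nn_integral_observation_law[OF PX, symmetric]) measurable
  also have "\<dots> = emeasure (density ?M0 ?l) A"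
    by (subst emeasure_density) (auto simp: sets_observation_law)
  finally show "emeasure (observation_law d PX \<sigma> g1) A = emeasure (density ?M0 ?l) A" .
qed (simp add: observation_law_def)

text \<open>
  Completing the square: the square of the Cameron-Martin density for the shift \<open>t\<close> is
  \<open>exp (t\<^sup>2)\<close> times the Cameron-Martin density for the shift \<open>2 t\<close>, and the latter integrates to one.
\<close>

lemma likelihood_ratio_second_moment:
  assumes PX: "prob_space PX" "sets PX = sets (Rd d)"
    and [measurable]: "\<sigma> \<in> borel_measurable (Rd d)" "g0 \<in> borel_measurable (Rd d)" "g1 \<in> borel_measurable (Rd d)"
    and pos: "AE x in PX. 0 < \<sigma> x"
  shows "(\<integral>\<^sup>+z. (likelihood_ratio \<sigma> g0 g1 z)\<^sup>2 \<partial>observation_law d PX \<sigma> g0)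
       = (\<integral>\<^sup>+x. ennreal (exp (((g1 x - g0 x) / \<sigma> x)\<^sup>2)) \<partial>PX)"
    (is "(\<integral>\<^sup>+z. (?l z)\<^sup>2 \<partial>?M0) = _")
proof -
  have "(\<integral>\<^sup>+z. (?l z)\<^sup>2 \<partial>?M0) = (\<integral>\<^sup>+x. \<integral>\<^sup>+e. (?l (x, g0 x + \<sigma> x * e))\<^sup>2 \<partial>std_normal \<partial>PX)"
    by (rule nn_integral_observation_law[OF PX]) measurable
  also have "\<dots> = (\<integral>\<^sup>+x. ennreal (exp (((g1 x - g0 x) / \<sigma> x)\<^sup>2)) \<partial>PX)"
    using pos
  proof (intro nn_integral_cong_AE, eventually_elim)
    case (elim x)
    let ?t = "(g1 x - g0 x) / \<sigma> x"
    have "(?l (x, g0 x + \<sigma> x * e))\<^sup>2 = ennreal (exp (?t\<^sup>2)) * ennreal (exp (e * (2 * ?t) - (2 * ?t)\<^sup>2 / 2))" for e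
    proof -
      have "(?l (x, g0 x + \<sigma> x * e))\<^sup>2 = ennreal ((exp (e * ?t - ?t\<^sup>2 / 2))\<^sup>2)"
        using elim by (simp add: likelihood_ratio_def Let_def ennreal_power)
      also have "(exp (e * t - t\<^sup>2 / 2))\<^sup>2 = exp (t\<^sup>2) * exp (e * (2 * t) - (2 * t)\<^sup>2 / 2)" for t :: real
        unfolding power2_eq_square mult_exp_exp by (simp add: algebra_simps)
      finally show ?thesis by (simp add: ennreal_mult)
    qed
    then have "(\<integral>\<^sup>+e. (?l (x, g0 x + \<sigma> x * e))\<^sup>2 \<partial>std_normal)
        = ennreal (exp (?t\<^sup>2)) * (\<integral>\<^sup>+e. ennreal (exp (e * (2 * ?t) - (2 * ?t)\<^sup>2 / 2)) \<partial>std_normal)"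
      by (simp add: nn_integral_cmult)
    then show ?case by (simp only: nn_integral_std_normal_exp mult_1_right)
  qed
  finally show ?thesis .
qed

lemma measurable_inner_d[measurable]: "inner_d d \<theta> \<in> borel_measurable (Rd d)"
  unfolding inner_d_def[abs_def]
  by (intro borel_measurable_sum borel_measurable_times measurable_component_singleton) auto

lemma nn_integral_indicator_index:
  assumes "sets PX = sets (Rd d)" and [measurable]: "S \<in> sets borel"
  shows "(\<integral>\<^sup>+x. indicator S (inner_d d \<theta> x) \<partial>PX) = emeasure (index_law d PX \<theta>) S"
proof -
  note [measurable_cong] = assms(1)
  have "emeasure (index_law d PX \<theta>) S = (\<integral>\<^sup>+z. indicator S z \<partial>index_law d PX \<theta>)"
    by (simp add: index_law_def)
  also have "\<dots> = (\<integral>\<^sup>+x. indicator S (inner_d d \<theta> x) \<partial>PX)"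
    unfolding index_law_def by (rule nn_integral_distr) measurable
  finally show ?thesis ..
qed

text \<open>
  Outside \<open>J\<close> the two regression functions agree and the exponential in the second moment is \<open>1\<close>; on \<open>J\<close>
  it is at most \<open>1 + 2 (A / \<tau>)\<^sup>2\<close>. The excess over \<open>1\<close> is thus proportional to the mass \<open>p\<close> of \<open>J\<close>, and
  it survives the \<open>n\<close>-th power as long as \<open>n\<close> times the excess is at most \<open>1 / 2\<close>, because \<open>exp (1 / 2) \<le> 2\<close>.
\<close>

lemma chi_square_local_perturbation:
  fixes A p \<tau> :: real
  assumes PX: "prob_space PX" "sets PX = sets (Rd d)"
    and [measurable]: "\<sigma> \<in> borel_measurable (Rd d)" "g0 \<in> borel_measurable (Rd d)" "g1 \<in> borel_measurable (Rd d)"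
    and \<sigma>: "AE x in PX. \<tau> < \<sigma> x" "0 < \<tau>"
    and diff: "\<And>x. \<bar>g1 x - g0 x\<bar> \<le> A * indicator J (inner_d d \<theta> x)"
    and J[measurable]: "J \<in> sets borel" and pJ: "emeasure (index_law d PX \<theta>) J \<le> ennreal p" "0 \<le> p"
    and A: "0 \<le> A" "A \<le> \<tau>" and n: "real n * (2 * (A / \<tau>)\<^sup>2 * p) \<le> 1 / 2"
  shows "(\<integral>\<^sup>+z. (likelihood_ratio \<sigma> g0 g1 z)\<^sup>2 \<partial>observation_law d PX \<sigma> g0) ^ n \<le> 2"
proof -
  interpret PX: prob_space PX by (rule PX)
  note [measurable_cong] = PX(2)
  let ?b = "2 * (A / \<tau>)\<^sup>2"
  have pos: "AE x in PX. 0 < \<sigma> x" using \<sigma>(1) by eventually_elim (use \<sigma>(2) in auto)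
  have "(\<integral>\<^sup>+z. (likelihood_ratio \<sigma> g0 g1 z)\<^sup>2 \<partial>observation_law d PX \<sigma> g0)
      = (\<integral>\<^sup>+x. ennreal (exp (((g1 x - g0 x) / \<sigma> x)\<^sup>2)) \<partial>PX)"
    by (rule likelihood_ratio_second_moment[OF PX _ _ _ pos]) measurable
  also have "\<dots> \<le> (\<integral>\<^sup>+x. 1 + ennreal ?b * indicator J (inner_d d \<theta> x) \<partial>PX)"
    using \<sigma>(1)
  proof (intro nn_integral_mono_AE, eventually_elim)
    case (elim x)
    show ?case
    proof (cases "inner_d d \<theta> x \<in> J")
      case False
      then show ?thesis using diff[of x] by simp
    next
      case True
      have "\<bar>(g1 x - g0 x) / \<sigma> x\<bar> \<le> A / \<tau>"
        unfolding abs_divide using diff[of x] True elim \<sigma>(2) A by (intro frac_le) auto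
      then have le: "((g1 x - g0 x) / \<sigma> x)\<^sup>2 \<le> (A / \<tau>)\<^sup>2"
        by (metis abs_ge_zero power2_abs power_mono)
      have "A / \<tau> \<le> 1" using A \<sigma>(2) by simp
      then have "(A / \<tau>)\<^sup>2 \<le> 1" using A \<sigma>(2) by (simp add: power_le_one)
      moreover from this have "((A / \<tau>)\<^sup>2)\<^sup>2 \<le> (A / \<tau>)\<^sup>2"
        by (subst power2_eq_square) (rule mult_left_le, auto)
      ultimately have "exp ((A / \<tau>)\<^sup>2) \<le> 1 + ?b"
        using exp_bound[of "(A / \<tau>)\<^sup>2"] by simp
      with le have "exp (((g1 x - g0 x) / \<sigma> x)\<^sup>2) \<le> 1 + ?b"
        by (meson exp_le_cancel_iff order_trans)
      then have "ennreal (exp (((g1 x - g0 x) / \<sigma> x)\<^sup>2)) \<le> ennreal (1 + ?b)" by (rule ennreal_leI)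
      then show ?thesis using True by simp
    qed
  qed
  also have "\<dots> = 1 + ennreal ?b * emeasure (index_law d PX \<theta>) J"
    by (simp add: nn_integral_add nn_integral_cmult nn_integral_indicator_index PX PX.emeasure_space_1)
  also have "\<dots> \<le> 1 + ennreal ?b * ennreal p"
    by (intro add_left_mono mult_left_mono pJ) auto
  also have "\<dots> = ennreal (1 + ?b * p)"
    using pJ(2) by (simp add: ennreal_mult)
  finally have "(\<integral>\<^sup>+z. (likelihood_ratio \<sigma> g0 g1 z)\<^sup>2 \<partial>observation_law d PX \<sigma> g0) ^ n \<le> ennreal (1 + ?b * p) ^ n"
    by (rule power_mono) simp
  also have "\<dots> = ennreal ((1 + ?b * p) ^ n)"
    using pJ(2) by (intro ennreal_power) auto
  also have "\<dots> \<le> ennreal 2"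
  proof (rule ennreal_leI)
    have "(1 + ?b * p) ^ n \<le> exp (?b * p) ^ n"
      using pJ(2) by (intro power_mono exp_ge_add_one_self) auto
    also have "\<dots> = exp (real n * (?b * p))" by (simp add: exp_of_nat_mult)
    also have "\<dots> \<le> exp (1/2)" using n by simp
    also have "\<dots> \<le> 2" using exp_bound_half[of "1/2::real"] by simp
    finally show "(1 + ?b * p) ^ n \<le> 2" .
  qed
  finally show ?thesis by simp
qed

section \<open>Averaging over the vertices of a hypercube\<close>

lemma sum_Pow_insert:
  fixes F :: "'a set \<Rightarrow> 'b :: comm_monoid_add"
  assumes "finite A" "k \<notin> A"
  shows "sum F (Pow (insert k A)) = (\<Sum>w\<in>Pow A. F w + F (insert k w))"
proof -
  have "sum F (Pow (insert k A)) = sum F (Pow A) + sum F (insert k ` Pow A)"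
    unfolding Pow_insert using assms by (intro sum.union_disjoint) auto
  also have "sum F (insert k ` Pow A) = (\<Sum>w\<in>Pow A. F (insert k w))"
    by (subst sum.reindex) (use assms in \<open>auto simp: inj_on_def insert_eq_iff\<close>)
  finally show ?thesis by (simp add: sum.distrib)
qed

text \<open>
  For a fixed \<open>k\<close> the subsets of \<open>{..<m}\<close> pair off as \<open>w\<close> and \<open>insert k w\<close>, and each of the
  \<open>2\<^bsup>m-1\<^esup>\<close> pairs contributes at least \<open>T\<close> to the sum of \<open>I k\<close> over all subsets.
  If \<open>I k w\<close> is the error made in bin \<open>k\<close> under the parameter \<open>w\<close>, a bound \<open>S\<close> for the worst total error also bounds the average over \<open>w\<close>.
\<close>

lemma assouad_averaging:
  fixes I :: "nat \<Rightarrow> nat set \<Rightarrow> ennreal"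
  assumes pair: "\<And>k w. k < m \<Longrightarrow> w \<subseteq> {..<m} - {k} \<Longrightarrow> T \<le> I k w + I k (insert k w)"
    and S: "\<And>w. w \<subseteq> {..<m} \<Longrightarrow> (\<Sum>k<m. I k w) \<le> S"
  shows "of_nat m * T \<le> 2 * S"
proof (cases m)
  case (Suc m')
  have T: "2 ^ m' * T \<le> (\<Sum>w\<in>Pow {..<m}. I k w)" if k: "k < m" for k
  proof -
    have "2 ^ m' * T = (\<Sum>w\<in>Pow ({..<m} - {k}). T)"
      using k Suc by (simp add: card_Pow card_Diff_singleton)
    also have "\<dots> \<le> (\<Sum>w\<in>Pow ({..<m} - {k}). I k w + I k (insert k w))"
      using k by (intro sum_mono pair) auto
    also have "\<dots> = (\<Sum>w\<in>Pow (insert k ({..<m} - {k})). I k w)"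
      by (rule sum_Pow_insert[symmetric]) auto
    also have "insert k ({..<m} - {k}) = {..<m}" using k by auto
    finally show ?thesis .
  qed
  have "2 ^ m' * (of_nat m * T) = (\<Sum>k<m. 2 ^ m' * T)" by (simp add: mult_ac)
  also have "\<dots> \<le> (\<Sum>k<m. \<Sum>w\<in>Pow {..<m}. I k w)"
    by (intro sum_mono T) simp
  also have "\<dots> = (\<Sum>w\<in>Pow {..<m}. \<Sum>k<m. I k w)" by (rule sum.swap)
  also have "\<dots> \<le> (\<Sum>w\<in>Pow {..<m}. S)" by (intro sum_mono S) auto
  also have "\<dots> = 2 ^ m' * (2 * S)" by (simp add: card_Pow Suc mult_ac)
  finally show ?thesis
    by (subst (asm) ennreal_mult_le_mult_iff) (auto simp: power_eq_top_ennreal)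
qed simp

section \<open>The minimax lower bound\<close>

text \<open>
  Near a point where the continuous density takes the value \<open>v > 0\<close> it stays between \<open>v / 2\<close> and \<open>2 v\<close>.
\<close>

lemma assumption_D_interval:
  assumes "assumption_D P"
  obtains z0 r c where "0 < r" "0 < c"
    and "\<And>a b. z0 \<le> a \<Longrightarrow> a \<le> b \<Longrightarrow> b \<le> z0 + r \<Longrightarrow>
           ennreal (c * (b - a)) \<le> emeasure P {a..b} \<and> emeasure P {a..b} \<le> ennreal (4 * c * (b - a))"
proof -
  obtain \<mu> where P: "prob_space P" and cont: "continuous_on UNIV \<mu>" and nn: "\<And>z. 0 \<le> \<mu> z"
    and dens: "P = density lborel (\<lambda>z. ennreal (\<mu> z))"
    using assms unfolding assumption_D_def by blast
  have [measurable]: "\<mu> \<in> borel_measurable borel"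
    by (rule borel_measurable_continuous_onI[OF cont])
  have "\<exists>z. 0 < \<mu> z"
  proof (rule ccontr)
    assume "\<not> ?thesis"
    then have "\<mu> z = 0" for z using nn[of z] by (meson antisym not_less)
    then have "emeasure P (space P) = 0" by (simp add: dens emeasure_density)
    then show False using prob_space.emeasure_space_1[OF P] by simp
  qed
  then obtain z0 where z0: "0 < \<mu> z0" by blast
  then have "0 < \<mu> z0 / 2" by simp
  with cont obtain e where e: "0 < e" "\<And>y. dist y z0 < e \<Longrightarrow> dist (\<mu> y) (\<mu> z0) < \<mu> z0 / 2"
    unfolding continuous_on_iff by (metis UNIV_I)
  show thesis
  proof (rule that[of "e / 2" "\<mu> z0 / 2" z0])
    fix a b assume ab: "z0 \<le> a" "a \<le> b" "b \<le> z0 + e / 2"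
    have \<mu>: "\<mu> z0 / 2 \<le> \<mu> y" "\<mu> y \<le> 4 * (\<mu> z0 / 2)" if "y \<in> {a..b}" for y
    proof -
      have "dist y z0 < e" using that ab e(1) by (auto simp: dist_real_def)
      then have "\<bar>\<mu> y - \<mu> z0\<bar> < \<mu> z0 / 2" using e(2) by (simp add: dist_real_def)
      then show "\<mu> z0 / 2 \<le> \<mu> y" "\<mu> y \<le> 4 * (\<mu> z0 / 2)" using z0 by linarith+
    qed
    have em: "emeasure P {a..b} = (\<integral>\<^sup>+z. ennreal (\<mu> z) * indicator {a..b} z \<partial>lborel)"
      by (simp add: dens emeasure_density)
    have "ennreal (\<mu> z0 / 2 * (b - a)) = (\<integral>\<^sup>+z. ennreal (\<mu> z0 / 2) * indicator {a..b} z \<partial>lborel)"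
      using ab z0 by (subst nn_integral_cmult_indicator) (auto simp flip: ennreal_mult)
    also have "\<dots> \<le> emeasure P {a..b}"
      unfolding em using \<mu> by (intro nn_integral_mono) (auto simp: indicator_def intro!: ennreal_leI)
    finally have lower: "ennreal (\<mu> z0 / 2 * (b - a)) \<le> emeasure P {a..b}" .
    have "emeasure P {a..b} \<le> (\<integral>\<^sup>+z. ennreal (4 * (\<mu> z0 / 2)) * indicator {a..b} z \<partial>lborel)"
      unfolding em using \<mu> by (intro nn_integral_mono) (auto simp: indicator_def intro!: ennreal_leI)
    also have "\<dots> = ennreal (4 * (\<mu> z0 / 2) * (b - a))"
      using ab z0 by (subst nn_integral_cmult_indicator) (auto simp: ennreal_mult)
    finally show "ennreal (\<mu> z0 / 2 * (b - a)) \<le> emeasure P {a..b}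
        \<and> emeasure P {a..b} \<le> ennreal (4 * (\<mu> z0 / 2) * (b - a))"
      using lower by blast
  qed (use e z0 in auto)
qed

lemma ennreal_square_parallelogram:
  fixes u a b :: real
  shows "ennreal ((a - b)\<^sup>2 / 2) \<le> ennreal ((u - a)\<^sup>2) + ennreal ((u - b)\<^sup>2)"
proof -
  have "(a - b)\<^sup>2 / 2 \<le> (u - a)\<^sup>2 + (u - b)\<^sup>2"
    using zero_le_power2[of "2 * u - a - b"] by (simp add: power2_eq_square field_simps)
  then show ?thesis by (simp flip: ennreal_plus add: ennreal_leI)
qed

text \<open>
  The bound for a fixed number of bins. The hypothesis \<open>noise\<close> expresses that the \<open>n\<close> observations do
  not reveal whether the bump of a given bin is present.
\<close>

lemma minimax_risk_ge:
  fixes z0 r c s L Q a B \<sigma>0 \<sigma>1 :: real and m n d :: nat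
  defines "N \<equiv> strict_floor s" and "h \<equiv> r / real m"
  defines "A \<equiv> a * h powr s" and "\<kappa> \<equiv> (3/16) ^ (N + 2)"
  assumes design: "single_index_design d PX \<sigma> \<sigma>0 \<sigma>1 \<theta>" and "0 < \<sigma>0"
    and r: "0 < r" and c: "0 < c"
    and P: "\<And>x y. z0 \<le> x \<Longrightarrow> x \<le> y \<Longrightarrow> y \<le> z0 + r \<Longrightarrow>
           ennreal (c * (y - x)) \<le> emeasure (index_law d PX \<theta>) {x..y}
           \<and> emeasure (index_law d PX \<theta>) {x..y} \<le> ennreal (4 * c * (y - x))"
    and s: "0 < s" and a: "0 < a" and m: "0 < m"
    and B: "\<And>j x. j \<le> Suc N \<Longrightarrow> \<bar>bump N j x\<bar> \<le> B" and L: "4 * a * B \<le> L"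
    and Q: "A \<le> Q" and A\<sigma>: "A \<le> \<sigma>0"
    and noise: "real n * (2 * (A / \<sigma>0)\<^sup>2 * (4 * c * h)) \<le> 1 / 2"
  shows "ennreal (r * c * \<kappa>\<^sup>2 / 16 * A\<^sup>2) \<le> minimax_risk n d PX \<sigma> \<theta> (holder_bdd Q s L)"
proof -
  have PX: "prob_space PX" "sets PX = sets (Rd d)"
    and \<sigma>[measurable]: "\<sigma> \<in> borel_measurable (Rd d)" and \<sigma>0: "AE x in PX. \<sigma>0 < \<sigma> x \<and> \<sigma> x \<le> \<sigma>1"
    using design by (auto simp: single_index_design_def)
  interpret PX: prob_space PX by (rule PX)
  note [measurable_cong] = PX(2)
  have above: "AE x in PX. \<sigma>0 < \<sigma> x" using \<sigma>0 by eventually_elim simp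
  have pos: "AE x in PX. 0 < \<sigma> x" using above by eventually_elim (use \<open>0 < \<sigma>0\<close> in auto)
  have h: "0 < h" using r m by (simp add: h_def)
  have A0: "0 < A" using a h by (simp add: A_def)
  have \<kappa>: "0 < \<kappa>" by (simp add: \<kappa>_def)
  have mh: "real m * h = r" using m by (simp add: h_def)
  define f where "f = (\<lambda>w z. A * bump_sum N 0 z0 h w z)"
  define g where "g = (\<lambda>w x. f w (inner_d d \<theta> x))"
  have g[measurable]: "g w \<in> borel_measurable (Rd d)" for w
    unfolding g_def f_def by measurable
  have f_class: "f w \<in> holder_bdd Q s L" if "finite w" for w
    using bump_sum_in_holder_bdd[OF s h _ that, of a B L Q z0] B L Q a by (simp add: f_def A_def N_def)
  \<comment> \<open>The loss is counted on the middle halves of the bins only: there the bump is at least \<open>\<kappa>\<close>,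
    and the closed middle halves are disjoint, whereas closed bins share end points.\<close>
  define mid where "mid = (\<lambda>k. {z0 + (real k + 1/4) * h .. z0 + (real k + 3/4) * h})"
  define bin where "bin = (\<lambda>k. {z0 + real k * h .. z0 + (real k + 1) * h})"
  have [measurable]: "mid k \<in> sets borel" "bin k \<in> sets borel" for k
    by (auto simp: mid_def bin_def)
  have in_range: "(real k + 1) * h \<le> r" if "k < m" for k
    unfolding mh[symmetric] using that h by (intro mult_right_mono) auto
  have g_insert: "g (insert k w) x - g w x = A * bump N 0 ((inner_d d \<theta> x - z0) / h - real k)"
    if "finite w" "k \<notin> w" for k w x
    using that by (simp add: g_def f_def bump_sum_insert algebra_simps)
  have diff_le: "\<bar>g (insert k w) x - g w x\<bar> \<le> A * indicator (bin k) (inner_d d \<theta> x)"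
    if "finite w" "k \<notin> w" for k w x
  proof (cases "inner_d d \<theta> x \<in> bin k")
    case True
    then show ?thesis
      using A0 bump_le_1 mult_left_le[of "\<bar>bump N 0 ((inner_d d \<theta> x - z0) / h - real k)\<bar>" A]
      by (simp add: g_insert[OF that] abs_mult)
  next
    case False
    then have "bump N 0 ((inner_d d \<theta> x - z0) / h - real k) = 0"
      using h by (intro bump_outside) (auto simp: bin_def field_simps)
    with False show ?thesis by (simp add: g_insert[OF that])
  qed
  have diff_ge: "A * \<kappa> \<le> g (insert k w) x - g w x"
    if "finite w" "k \<notin> w" "inner_d d \<theta> x \<in> mid k" for k w x
    unfolding g_insert[OF that(1,2)] \<kappa>_def using A0 that(3) h
    by (intro mult_left_mono bump_middle) (auto simp: mid_def field_simps)
  \<comment> \<open>Lower bound for the sum of the local losses of one and the same estimate at two neighbouring vertices.\<close>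
  define t where "t = ennreal ((A * \<kappa>)\<^sup>2 / 2) * ennreal (c * (h / 2))"
  have "ennreal (r * c * \<kappa>\<^sup>2 / 16 * A\<^sup>2)
      \<le> (SUP f \<in> holder_bdd Q s L. let g = (\<lambda>x. f (inner_d d \<theta> x))
           in \<integral>\<^sup>+ D. L2_loss PX (ge D) g \<partial>sample_law n d PX \<sigma> g)" (is "_ \<le> ?S")
    if ge: "ge \<in> estimators n d" for ge
  proof -
    have ge_meas[measurable]: "(\<lambda>(D, x). ge D x) \<in> borel_measurable (PiM {..<n} (\<lambda>_. Rd d \<Otimes>\<^sub>M borel) \<Otimes>\<^sub>M Rd d)"
      using ge by (simp add: estimators_def)
    define loss where
      "loss = (\<lambda>k w D. \<integral>\<^sup>+x. ennreal ((ge D x - g w x)\<^sup>2) * indicator (mid k) (inner_d d \<theta> x) \<partial>PX)"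
    define I where "I = (\<lambda>k w. \<integral>\<^sup>+D. loss k w D \<partial>sample_law n d PX \<sigma> (g w))"
    have loss_meas: "loss k w \<in> borel_measurable (PiM {..<n} (\<lambda>_. Rd d \<Otimes>\<^sub>M borel))" for k w
      unfolding loss_def by measurable
    have sample_sets: "sets (PiM {..<n} (\<lambda>_. observation_law d PX \<sigma> g')) = sets (PiM {..<n} (\<lambda>_. Rd d \<Otimes>\<^sub>M borel))" for g'
      by (intro sets_PiM_cong refl sets_observation_law)
    have loss_meas'[measurable]: "loss k w \<in> borel_measurable (PiM {..<n} (\<lambda>_. observation_law d PX \<sigma> g'))" for k w g'
      using loss_meas measurable_cong_sets[OF sample_sets refl] by blast
    have ge_section: "ge D \<in> borel_measurable (Rd d)"
      if "D \<in> space (PiM {..<n} (\<lambda>_. Rd d \<Otimes>\<^sub>M borel))" for D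
      using measurable_Pair2[OF ge_meas that] by simp
    have pair: "t / 2 \<le> I k w + I k (insert k w)" if k: "k < m" and w: "w \<subseteq> {..<m} - {k}" for k w
    proof -
      have w': "finite w" "k \<notin> w" using w by (auto intro: finite_subset)
      let ?M0 = "observation_law d PX \<sigma> (g w)" and ?l = "likelihood_ratio \<sigma> (g w) (g (insert k w))"
      have dens: "observation_law d PX \<sigma> (g (insert k w)) = density ?M0 ?l"
        by (rule observation_law_density[OF PX _ _ _ pos]) measurable
      have "emeasure (index_law d PX \<theta>) (bin k) \<le> ennreal (4 * c * h)"
        using P[of "z0 + real k * h" "z0 + (real k + 1) * h"] in_range[OF k] h
        by (auto simp: bin_def algebra_simps)
      then have chi2: "(\<integral>\<^sup>+z. (?l z)\<^sup>2 \<partial>?M0) ^ n \<le> 2"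
        using A0 A\<sigma> noise c h \<open>0 < \<sigma>0\<close> above
        by (intro chi_square_local_perturbation[OF PX, where A = A and J = "bin k" and \<theta> = \<theta> and p = "4 * c * h" and \<tau> = \<sigma>0])
          (auto intro: diff_le[OF w'])
      have bound: "t \<le> loss k w D + loss k (insert k w) D" if D: "D \<in> space (PiM {..<n} (\<lambda>_. ?M0))" for D
      proof -
        have "D \<in> space (PiM {..<n} (\<lambda>_. Rd d \<Otimes>\<^sub>M borel))"
          using D sets_eq_imp_space_eq[OF sample_sets] by blast
        note [measurable] = ge_section[OF this]
        have "c * (h / 2) = c * ((z0 + (real k + 3/4) * h) - (z0 + (real k + 1/4) * h))"
          by (simp add: algebra_simps)
        also have "ennreal \<dots> \<le> emeasure (index_law d PX \<theta>) (mid k)"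
          unfolding mid_def
        proof (rule conjunct1[OF P])
          show "z0 \<le> z0 + (real k + 1/4) * h" using h by simp
          show "z0 + (real k + 1/4) * h \<le> z0 + (real k + 3/4) * h" using h by (simp add: mult_right_mono)
          have "(real k + 3/4) * h \<le> (real k + 1) * h" using h by (intro mult_right_mono) auto
          then show "z0 + (real k + 3/4) * h \<le> z0 + r" using in_range[OF k] by simp
        qed
        finally have "t \<le> ennreal ((A * \<kappa>)\<^sup>2 / 2) * emeasure (index_law d PX \<theta>) (mid k)"
          unfolding t_def by (intro mult_left_mono) auto
        also have "\<dots> = (\<integral>\<^sup>+x. ennreal ((A * \<kappa>)\<^sup>2 / 2) * indicator (mid k) (inner_d d \<theta> x) \<partial>PX)"
          by (simp add: nn_integral_cmult nn_integral_indicator_index PX)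
        also have "\<dots> \<le> (\<integral>\<^sup>+x. ennreal ((ge D x - g w x)\<^sup>2) * indicator (mid k) (inner_d d \<theta> x)
            + ennreal ((ge D x - g (insert k w) x)\<^sup>2) * indicator (mid k) (inner_d d \<theta> x) \<partial>PX)"
        proof (intro nn_integral_mono)
          fix x
          show "ennreal ((A * \<kappa>)\<^sup>2 / 2) * indicator (mid k) (inner_d d \<theta> x)
            \<le> ennreal ((ge D x - g w x)\<^sup>2) * indicator (mid k) (inner_d d \<theta> x)
              + ennreal ((ge D x - g (insert k w) x)\<^sup>2) * indicator (mid k) (inner_d d \<theta> x)"
          proof (cases "inner_d d \<theta> x \<in> mid k")
            case True
            have "(A * \<kappa>)\<^sup>2 \<le> (g (insert k w) x - g w x)\<^sup>2"
              using diff_ge[OF w' True] A0 \<kappa> by (intro power_mono) auto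
            then have "ennreal ((A * \<kappa>)\<^sup>2 / 2) \<le> ennreal ((g w x - g (insert k w) x)\<^sup>2 / 2)"
              by (intro ennreal_leI) (simp add: power2_commute)
            also note ennreal_square_parallelogram[of "g w x" "g (insert k w) x" "ge D x"]
            finally show ?thesis using True by simp
          qed simp
        qed
        also have "\<dots> = loss k w D + loss k (insert k w) D"
          unfolding loss_def by (intro nn_integral_add) measurable
        finally show ?thesis .
      qed
      have lr: "?l \<in> borel_measurable ?M0" by measurable
      have prob: "prob_space (density ?M0 ?l)"
        unfolding dens[symmetric] by (rule prob_space_observation_law[OF PX \<sigma> g])
      show ?thesis
        unfolding I_def sample_law_def dens
        by (rule two_point_bound[OF lr prob_space_observation_law[OF PX \<sigma> g] prob chi2 loss_meas' loss_meas' bound])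
    qed
    have "(\<Sum>k<m. I k w) \<le> ?S" if w: "w \<subseteq> {..<m}" for w
    proof -
      have disj: "(\<Sum>k<m. indicator (mid k) z) \<le> (1 :: ennreal)" for z
      proof -
        have "k = nat \<lfloor>(z - z0) / h\<rfloor>" if "z \<in> mid k" for k
        proof -
          have "real k \<le> (z - z0) / h" "(z - z0) / h < real k + 1"
            using that h by (auto simp: mid_def field_simps)
          then have "\<lfloor>(z - z0) / h\<rfloor> = int k" by (intro floor_unique) auto
          then show ?thesis by simp
        qed
        then have "(\<Sum>k<m. indicator (mid k) z) = (\<Sum>k\<in>{..<m} \<inter> {nat \<lfloor>(z - z0) / h\<rfloor>}. indicator (mid k) z :: ennreal)"
          by (intro sum.mono_neutral_right) (auto simp: indicator_def)
        also have "\<dots> \<le> 1"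
          by (cases "nat \<lfloor>(z - z0) / h\<rfloor> < m") (auto split: split_indicator)
        finally show ?thesis .
      qed
      have "(\<Sum>k<m. I k w) = (\<integral>\<^sup>+D. (\<Sum>k<m. loss k w D) \<partial>sample_law n d PX \<sigma> (g w))"
        unfolding I_def sample_law_def by (simp add: nn_integral_sum)
      also have "\<dots> \<le> (\<integral>\<^sup>+D. L2_loss PX (ge D) (g w) \<partial>sample_law n d PX \<sigma> (g w))"
      proof (intro nn_integral_mono)
        fix D assume "D \<in> space (sample_law n d PX \<sigma> (g w))"
        then have "D \<in> space (PiM {..<n} (\<lambda>_. Rd d \<Otimes>\<^sub>M borel))"
          unfolding sample_law_def using sets_eq_imp_space_eq[OF sample_sets] by blast
        note [measurable] = ge_section[OF this]
        have "(\<Sum>k<m. loss k w D)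
            = (\<integral>\<^sup>+x. ennreal ((ge D x - g w x)\<^sup>2) * (\<Sum>k<m. indicator (mid k) (inner_d d \<theta> x)) \<partial>PX)"
          unfolding loss_def sum_distrib_left by (intro nn_integral_sum[symmetric]) measurable
        also have "\<dots> \<le> (\<integral>\<^sup>+x. ennreal ((ge D x - g w x)\<^sup>2) * 1 \<partial>PX)"
          by (intro nn_integral_mono mult_left_mono disj) auto
        finally show "(\<Sum>k<m. loss k w D) \<le> L2_loss PX (ge D) (g w)"
          by (simp add: L2_loss_def)
      qed
      also have "\<dots> \<le> ?S"
        using f_class[of w] w by (intro SUP_upper2[of "f w"]) (auto simp: Let_def g_def intro: finite_subset)
      finally show ?thesis .
    qed
    from assouad_averaging[OF pair this] have "of_nat m * (t / 2) \<le> 2 * ?S" .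
    moreover have "of_nat m * (t / 2) = 2 * ennreal (r * c * \<kappa>\<^sup>2 / 16 * A\<^sup>2)"
    proof -
      let ?X = "(A * \<kappa>)\<^sup>2 / 2 * (c * (h / 2))"
      have "t = ennreal ?X"
        unfolding t_def using c h by (intro ennreal_mult[symmetric]) auto
      then have "t / 2 = ennreal (?X / 2)"
        using c h divide_ennreal[of ?X 2] by simp
      then have "of_nat m * (t / 2) = ennreal (real m * ((A * \<kappa>)\<^sup>2 / 2 * (c * (h / 2)) / 2))"
        using c h by (simp only: ennreal_of_nat_eq_real_of_nat) (intro ennreal_mult[symmetric], auto)
      also have "real m * ((A * \<kappa>)\<^sup>2 / 2 * (c * (h / 2)) / 2) = 2 * (r * c * \<kappa>\<^sup>2 / 16 * A\<^sup>2)"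
        unfolding mh[symmetric] by (simp add: power_mult_distrib)
      also have "ennreal \<dots> = 2 * ennreal (r * c * \<kappa>\<^sup>2 / 16 * A\<^sup>2)"
        using r c ennreal_mult[of 2 "r * c * \<kappa>\<^sup>2 / 16 * A\<^sup>2"] by simp
      finally show ?thesis .
    qed
    ultimately have "2 * ennreal (r * c * \<kappa>\<^sup>2 / 16 * A\<^sup>2) \<le> 2 * ?S" by (simp only:)
    then show ?thesis
      by (subst (asm) ennreal_mult_le_mult_iff) auto
  qed
  then show ?thesis
    unfolding minimax_risk_def by (intro INF_greatest) auto
qed

text \<open>
  Balancing: with \<open>m\<close> the ceiling of \<open>n\<^bsup>1/(2s+1)\<^esup>\<close> the width \<open>h\<close> lies between \<open>r / 2\<close> and \<open>r\<close> times
  \<open>n\<^bsup>-1/(2s+1)\<^esup>\<close>, so \<open>n h\<^bsup>2s+1\<^esup>\<close> stays bounded while \<open>h\<^bsup>2s\<^esup>\<close> has the order of the rate. The factor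
  \<open>1 + 4 sqrt (r c)\<close> serves two purposes at once: its first summand gives \<open>A \<le> \<sigma>0\<close>, its second
  one that \<open>n\<close> observations carry little information about a single bump.
\<close>

lemma minimax_risk_ge_rate:
  fixes z0 r c s L Q a B \<sigma>0 \<sigma>1 :: real and n d :: nat
  defines "N \<equiv> strict_floor s"
  assumes design: "single_index_design d PX \<sigma> \<sigma>0 \<sigma>1 \<theta>" and \<sigma>0: "0 < \<sigma>0"
    and r: "0 < r" and c: "0 < c"
    and P: "\<And>x y. z0 \<le> x \<Longrightarrow> x \<le> y \<Longrightarrow> y \<le> z0 + r \<Longrightarrow>
           ennreal (c * (y - x)) \<le> emeasure (index_law d PX \<theta>) {x..y}
           \<and> emeasure (index_law d PX \<theta>) {x..y} \<le> ennreal (4 * c * (y - x))"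
    and s: "0 < s" and a: "0 < a" and n: "1 \<le> n"
    and B: "\<And>j x. j \<le> Suc N \<Longrightarrow> \<bar>bump N j x\<bar> \<le> B" and L: "4 * a * B \<le> L"
    and a\<sigma>: "a * r powr s * (1 + 4 * sqrt (r * c)) \<le> \<sigma>0"
    and Q: "a * r powr s * real n powr (- s / (2 * s + 1)) \<le> Q"
  shows "ennreal (r * c * ((3/16) ^ (N + 2))\<^sup>2 / 16 * a\<^sup>2 * (r / 2) powr (2 * s) * real n powr (- (2 * s) / (2 * s + 1)))
       \<le> minimax_risk n d PX \<sigma> \<theta> (holder_bdd Q s L)"
proof -
  define x where "x = real n powr (1 / (2 * s + 1))"
  define m where "m = nat \<lceil>x\<rceil>"
  define h where "h = r / real m"
  define A where "A = a * h powr s"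
  have x1: "1 \<le> x" unfolding x_def using n s by (intro ge_one_powr_ge_zero) auto
  have m: "x \<le> real m" "real m \<le> 2 * x" "0 < m"
    using x1 unfolding m_def by (auto, linarith+)
  have h: "0 < h" "h \<le> r / x" "r / 2 / x \<le> h" "h \<le> r"
  proof -
    show "0 < h" "h \<le> r / x" using m x1 r by (auto simp: h_def intro!: frac_le)
    have "r / (2 * x) \<le> r / real m" using m r by (intro frac_le) auto
    then show "r / 2 / x \<le> h" by (simp add: h_def)
    have "r / real m \<le> r / 1" using m r by (intro divide_left_mono) auto
    then show "h \<le> r" by (simp add: h_def)
  qed
  have xs: "x powr (2 * s + 1) = real n" "x powr s = real n powr (s / (2 * s + 1))"
      "x powr (2 * s) = real n powr ((2 * s) / (2 * s + 1))"
    using n s by (auto simp: x_def powr_powr)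
  have neg: "real n powr (- s / (2 * s + 1)) = 1 / x powr s"
      "real n powr (- (2 * s) / (2 * s + 1)) = 1 / x powr (2 * s)"
    unfolding xs minus_divide_left[symmetric] powr_minus_divide by (rule refl)+
  have "h powr s \<le> (r / x) powr s" using h s by (intro powr_mono2) auto
  also have "\<dots> = r powr s * real n powr (- s / (2 * s + 1))"
    unfolding neg using r x1 by (simp add: powr_divide)
  finally have "A \<le> a * r powr s * real n powr (- s / (2 * s + 1))"
    using a by (simp add: A_def mult.assoc)
  with Q have AQ: "A \<le> Q" by simp
  define K where "K = a * r powr s"
  have K0: "0 < K" using a r by (simp add: K_def)
  have K\<sigma>: "K * (1 + 4 * sqrt (r * c)) \<le> \<sigma>0" using a\<sigma> by (simp add: K_def)
  have "h powr s \<le> r powr s" using h s by (intro powr_mono2) auto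
  then have "A \<le> K" using a by (simp add: A_def K_def)
  also have "K * 1 \<le> K * (1 + 4 * sqrt (r * c))"
    using K0 r c by (intro mult_left_mono) auto
  then have "K \<le> \<sigma>0" using K\<sigma> by simp
  finally have A\<sigma>: "A \<le> \<sigma>0" .
  have A2: "A\<^sup>2 = a\<^sup>2 * h powr (2 * s)"
    using h by (simp add: A_def power_mult_distrib power2_eq_square flip: powr_add)
  have "K * (4 * sqrt (r * c)) \<le> K * (1 + 4 * sqrt (r * c))"
    using K0 by (intro mult_left_mono) auto
  then have "K * (4 * sqrt (r * c)) \<le> \<sigma>0" using K\<sigma> by simp
  then have "(K * (4 * sqrt (r * c)))\<^sup>2 \<le> \<sigma>0\<^sup>2"
    using K0 r c by (intro power_mono) auto
  then have K2: "16 * (K\<^sup>2 * r * c) \<le> \<sigma>0\<^sup>2"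
    using r c by (simp add: power_mult_distrib mult_ac)
  have nh: "real n * (A\<^sup>2 * h) \<le> K\<^sup>2 * r"
  proof -
    have "h powr (2 * s + 1) \<le> (r / x) powr (2 * s + 1)"
      using h s by (intro powr_mono2) auto
    also have "\<dots> = r powr (2 * s + 1) / real n"
      using r x1 by (simp add: powr_divide xs)
    finally have "real n * h powr (2 * s + 1) \<le> r powr (2 * s + 1)"
      using n by (simp add: field_simps)
    then have "a\<^sup>2 * (real n * h powr (2 * s + 1)) \<le> a\<^sup>2 * r powr (2 * s + 1)"
      by (rule mult_left_mono) simp
    moreover have "K\<^sup>2 = a\<^sup>2 * r powr (2 * s)"
      using r by (simp add: K_def power_mult_distrib power2_eq_square flip: powr_add)
    ultimately show ?thesis
      using h r by (simp add: A2 powr_add mult_ac)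
  qed
  have noise: "real n * (2 * (A / \<sigma>0)\<^sup>2 * (4 * c * h)) \<le> 1 / 2"
  proof -
    have "real n * (2 * (A / \<sigma>0)\<^sup>2 * (4 * c * h)) = 8 * c * (real n * (A\<^sup>2 * h)) / \<sigma>0\<^sup>2"
      by (simp add: power_divide)
    also have "\<dots> \<le> 8 * c * (K\<^sup>2 * r) / \<sigma>0\<^sup>2"
      using nh c by (intro divide_right_mono mult_left_mono) auto
    also have "\<dots> \<le> 1 / 2"
      using K2 \<sigma>0 by (simp add: field_simps)
    finally show ?thesis .
  qed
  have "(r / 2) powr (2 * s) * real n powr (- (2 * s) / (2 * s + 1)) = (r / 2 / x) powr (2 * s)"
    unfolding neg using r x1 powr_divide[of "r / 2" x "2 * s"] by (simp only: times_divide_eq_right mult_1_right)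
  also have "\<dots> \<le> h powr (2 * s)"
    using h r x1 s by (intro powr_mono2) auto
  finally have "a\<^sup>2 * ((r / 2) powr (2 * s) * real n powr (- (2 * s) / (2 * s + 1))) \<le> A\<^sup>2"
    unfolding A2 by (rule mult_left_mono) simp
  then have "r * c * ((3/16) ^ (N + 2))\<^sup>2 / 16 * (a\<^sup>2 * ((r / 2) powr (2 * s) * real n powr (- (2 * s) / (2 * s + 1))))
      \<le> r * c * ((3/16) ^ (N + 2))\<^sup>2 / 16 * A\<^sup>2"
    using r c by (intro mult_left_mono) auto
  then have "ennreal (r * c * ((3/16) ^ (N + 2))\<^sup>2 / 16 * a\<^sup>2 * (r / 2) powr (2 * s) * real n powr (- (2 * s) / (2 * s + 1)))
      \<le> ennreal (r * c * ((3/16) ^ (N + 2))\<^sup>2 / 16 * A\<^sup>2)"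
    by (intro ennreal_leI) (simp only: mult.assoc)
  also have "\<dots> \<le> minimax_risk n d PX \<sigma> \<theta> (holder_bdd Q s L)"
    unfolding A_def h_def N_def
    by (rule minimax_risk_ge[OF design \<sigma>0 r c P s a m(3) B[unfolded N_def] L
          AQ[unfolded A_def h_def] A\<sigma>[unfolded A_def h_def] noise[unfolded A_def h_def]])
  finally show ?thesis .
qed

theorem theorem2:
  fixes s L \<sigma>0 \<sigma>1 :: real and P :: "real measure"
  assumes "0 < s" and "0 < L" and "0 < \<sigma>0" and "0 < \<sigma>1"
    and "assumption_D P"
  shows "\<exists>C'>0. \<forall>Q>0.
    (\<exists>N. \<forall>n\<ge>N. \<forall>d PX \<sigma> \<theta>.
       1 \<le> n \<longrightarrow> single_index_design d PX \<sigma> \<sigma>0 \<sigma>1 \<theta> \<longrightarrow> index_law d PX \<theta> = P \<longrightarrow>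
       ennreal (C' * real n powr (- (2 * s) / (2 * s + 1)))
         \<le> minimax_risk n d PX \<sigma> \<theta> (holder_bdd Q s L))
    \<and> (\<exists>CQ>0. \<forall>n\<ge>1. \<forall>d PX \<sigma> \<theta>.
       single_index_design d PX \<sigma> \<sigma>0 \<sigma>1 \<theta> \<longrightarrow> index_law d PX \<theta> = P \<longrightarrow>
       ennreal (CQ * real n powr (- (2 * s) / (2 * s + 1)))
         \<le> minimax_risk n d PX \<sigma> \<theta> (holder_bdd Q s L))"
proof -
  obtain z0 r c where r: "0 < r" and c: "0 < c"
    and P: "\<And>x y. z0 \<le> x \<Longrightarrow> x \<le> y \<Longrightarrow> y \<le> z0 + r \<Longrightarrow>
      ennreal (c * (y - x)) \<le> emeasure P {x..y} \<and> emeasure P {x..y} \<le> ennreal (4 * c * (y - x))"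
    by (rule assumption_D_interval[OF assms(5)]) blast
  obtain B where B0: "0 < B"
    and B: "\<And>j x. j \<le> Suc (strict_floor s) \<Longrightarrow> \<bar>bump (strict_floor s) j x\<bar> \<le> B"
    by (rule bump_bounded[of "strict_floor s"]) blast
  define W where "W = r powr s * (1 + 4 * sqrt (r * c))"
  have W: "0 < W" using r c unfolding W_def by (intro mult_pos_pos add_pos_nonneg) auto
  define a0 where "a0 = min (L / (4 * B)) (\<sigma>0 / W)"
  have a0: "0 < a0" using B0 W assms by (simp add: a0_def)
  have adm: "4 * a * B \<le> L \<and> a * r powr s * (1 + 4 * sqrt (r * c)) \<le> \<sigma>0" if "a \<le> a0" for a
  proof -
    have "a \<le> L / (4 * B)" "a \<le> \<sigma>0 / W" using that by (auto simp: a0_def)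
    then have "a * (4 * B) \<le> L" "a * W \<le> \<sigma>0"
      using B0 W by (simp_all add: pos_le_divide_eq)
    then show ?thesis by (simp add: W_def mult_ac)
  qed
  define C where
    "C = (\<lambda>a. r * c * ((3/16) ^ (strict_floor s + 2))\<^sup>2 / 16 * a\<^sup>2 * (r / 2) powr (2 * s))"
  have C: "0 < C a" if "0 < a" for a using that r c by (auto simp: C_def)
  have rate: "ennreal (C a * real n powr (- (2 * s) / (2 * s + 1))) \<le> minimax_risk n d PX \<sigma> \<theta> (holder_bdd Q s L)"
    if "0 < a" "a \<le> a0" "1 \<le> n" "a * r powr s * real n powr (- s / (2 * s + 1)) \<le> Q"
      "single_index_design d PX \<sigma> \<sigma>0 \<sigma>1 \<theta>" "index_law d PX \<theta> = P"
    for a Q n d PX \<sigma> \<theta>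
    unfolding C_def
    by (rule minimax_risk_ge_rate[OF that(5) assms(3) r c P[folded that(6)] assms(1) that(1,3) B
          conjunct1[OF adm[OF that(2)]] conjunct2[OF adm[OF that(2)]] that(4)])
  show ?thesis
  proof (rule exI[of _ "C a0"], intro conjI allI impI)
    show "0 < C a0" by (rule C[OF a0])
  next
    fix Q :: real assume Q: "0 < Q"
    have "filterlim (\<lambda>n. real n) at_top sequentially" by (rule filterlim_real_sequentially)
    then have "(\<lambda>n. real n powr (- s / (2 * s + 1))) \<longlonglongrightarrow> 0"
      using assms(1) by (intro tendsto_neg_powr) auto
    then have "(\<lambda>n. a0 * r powr s * real n powr (- s / (2 * s + 1))) \<longlonglongrightarrow> 0"
      by (rule tendsto_mult_right_zero)
    then have "\<forall>\<^sub>F n in sequentially. a0 * r powr s * real n powr (- s / (2 * s + 1)) < Q"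
      using Q by (rule order_tendstoD)
    then obtain N where "\<And>n. N \<le> n \<Longrightarrow> a0 * r powr s * real n powr (- s / (2 * s + 1)) < Q"
      unfolding eventually_sequentially by blast
    then show "\<exists>N. \<forall>n\<ge>N. \<forall>d PX \<sigma> \<theta>.
       1 \<le> n \<longrightarrow> single_index_design d PX \<sigma> \<sigma>0 \<sigma>1 \<theta> \<longrightarrow> index_law d PX \<theta> = P \<longrightarrow>
       ennreal (C a0 * real n powr (- (2 * s) / (2 * s + 1)))
         \<le> minimax_risk n d PX \<sigma> \<theta> (holder_bdd Q s L)"
      by (intro exI[of _ N] allI impI rate[OF a0 order_refl _ less_imp_le])
  next
    fix Q :: real assume Q: "0 < Q"
    \<comment> \<open>Since \<open>n\<^bsup>-s/(2s+1)\<^esup> \<le> 1\<close>, this amplitude respects \<open>Q\<close> for every \<open>n\<close>.\<close>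
    define a where "a = min a0 (Q / r powr s)"
    have a: "0 < a" "a \<le> a0" using a0 Q r by (auto simp: a_def)
    have aQ: "a * r powr s * real n powr (- s / (2 * s + 1)) \<le> Q" if "1 \<le> n" for n
    proof -
      have "real n powr (- s / (2 * s + 1)) \<le> real n powr 0"
        using that assms(1) by (intro powr_mono) (auto simp: divide_nonpos_pos)
      then have "a * r powr s * real n powr (- s / (2 * s + 1)) \<le> a * r powr s * 1"
        using that a(1) by (intro mult_left_mono) auto
      also have "\<dots> \<le> Q / r powr s * r powr s"
        unfolding a_def mult_1_right by (intro mult_right_mono) auto
      also have "\<dots> = Q" using r by simp
      finally show ?thesis .
    qed
    show "\<exists>CQ>0. \<forall>n\<ge>1. \<forall>d PX \<sigma> \<theta>.
       single_index_design d PX \<sigma> \<sigma>0 \<sigma>1 \<theta> \<longrightarrow> index_law d PX \<theta> = P \<longrightarrow>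
       ennreal (CQ * real n powr (- (2 * s) / (2 * s + 1)))
         \<le> minimax_risk n d PX \<sigma> \<theta> (holder_bdd Q s L)"
      by (intro exI[of _ "C a"] conjI C[OF a(1)] allI impI rate[OF a _ aQ])
  qed
qed

end
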